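(* Consider $n$ jobs on a single machine with weights $w_j\ge0$, release dates $r_j\ge0$, independent non-negative random processing times $\bm p_j$ with $\bar p_j=\mathrm E[\bm p_j]>0$ and $\mathrm{CV}[\bm p_j]^2\le\Delta$ for all $j$, indexed so that $w_1/\bar p_1\ge\cdots\ge w_n/\bar p_n$. Let $f$ be a probability density function on $(0,1]$ and $c\in\mathbb R$ such that for all $x\in(0,1]$: (1) $\int_0^x\bigl(1-g(\Delta)(x-\alpha)\bigr)f(\alpha)\,\mathrm d\alpha\le(c-1)x$; (2) $\bigl(2-g(\Delta)(1-\int_0^1\alpha f(\alpha)\,\mathrm d\alpha)\bigr)\int_{1-x}^1f(\alpha)\,\mathrm d\alpha\le cx$. Then \[\mathrm E\Bigl[\sum_{j=1}^nw_j\bm C_j^{\mathrm{RSOS}(f)}\Bigr]\le c\sum_{j=1}^nw_j\Bigl(M_j^{\mathrm{S^p}}+\frac{\bar p_j}2\Bigr)\le c\,\mathrm E\Bigl[\sum_{j=1}^nw_j\bm C_j^{\mathrm{OPT}}\Bigr],\] where $\mathrm{OPT}$ is an optimal (non-preemptive, non-anticipative) scheduling policy.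
   Context: $\mathrm{CV}[\bm p]^2:=\mathrm{Var}[\bm p]/\mathrm E[\bm p]^2$; $g(\Delta):=(2-\sqrt\Delta)/2$ for $\Delta\le1$, $g(\Delta):=1/(\Delta+1)$ for $\Delta\ge1$. A scheduling policy is non-preemptive, never starts $j$ before $r_j$, and is non-anticipative. $\mathrm{S^p}$ is the preemptive WSPT schedule of the deterministic counterparts (processing times $\bar p_j$): at each time the released unfinished job of smallest index is processed; $I_j^{\mathrm{S^p}}(t)\in\{0,1\}$ indicates processing of $j$ at $t$; $M_j^{\mathrm{S^p}}:=\frac1{\bar p_j}\int_0^\infty I_j^{\mathrm{S^p}}(t)t\,\mathrm dt$; the $\alpha$-point is $C_j(\alpha):=\min\{t\ge0:\int_0^tI_j^{\mathrm{S^p}}(s)\mathrm ds\ge\alpha\bar p_j\}$. The $\mathrm{RSOS}(f)$ policy: at release of $j$ it draws $\bm\alpha_j\in(0,1]$ with density $f$, independently of everything else; it virtually constructs $\mathrm{S^p}$ over time and appends $j$ to a FIFO queue at time $C_j(\bm\alpha_j)$; the machine processes the queue in FIFO order without idling while the queue is nonempty. *)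

theory Defs
  imports "HOL-Probability.Probability"
begin

section \<open>Parameters\<close>

text \<open>The jobs are \<open>{1..n}\<close>; functions on jobs are only ever evaluated there.\<close>

definition cv_squared :: "'a measure \<Rightarrow> ('a \<Rightarrow> real) \<Rightarrow> real" where
  "cv_squared M X = prob_space.variance M X / (prob_space.expectation M X)\<^sup>2"

definition gfun :: "real \<Rightarrow> real" where
  "gfun \<Delta> = (if \<Delta> \<le> 1 then (2 - sqrt \<Delta>) / 2 else 1 / (\<Delta> + 1))"

text \<open>Only the values of \<open>f\<close> on \<open>(0,1]\<close> matter.\<close>

definition unit_density :: "(real \<Rightarrow> real) \<Rightarrow> bool" where
  "unit_density f \<longleftrightarrow>
     set_integrable lborel {0<..1} f \<and> (\<forall>x\<in>{0<..1}. 0 \<le> f x) \<and> (LBINT x:{0<..1}. f x) = 1"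


section \<open>The preemptive WSPT schedule of the deterministic counterparts\<close>

text \<open>\<open>I j t\<close> is the indicator of job \<open>j\<close> being processed at time \<open>t\<close>, and \<open>q j\<close> its
  deterministic processing time.\<close>

definition pending ::
    "(nat \<Rightarrow> real) \<Rightarrow> (nat \<Rightarrow> real) \<Rightarrow> (nat \<Rightarrow> real \<Rightarrow> real) \<Rightarrow> nat \<Rightarrow> real \<Rightarrow> bool" where
  "pending r q I j t \<longleftrightarrow> r j \<le> t \<and> (LBINT s:{0..t}. I j s) < q j"

definition preemptive_wspt ::
    "nat \<Rightarrow> (nat \<Rightarrow> real) \<Rightarrow> (nat \<Rightarrow> real) \<Rightarrow> (nat \<Rightarrow> real \<Rightarrow> real) \<Rightarrow> bool" where
  "preemptive_wspt n r q I \<longleftrightarrow>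
     (\<forall>t\<ge>0. \<forall>j\<in>{1..n}.
        I j t = (if pending r q I j t \<and> (\<forall>i\<in>{1..<j}. \<not> pending r q I i t) then 1 else 0))"

definition mean_busy_time :: "(nat \<Rightarrow> real) \<Rightarrow> (nat \<Rightarrow> real \<Rightarrow> real) \<Rightarrow> nat \<Rightarrow> real" where
  "mean_busy_time q I j = 1 / q j * (LBINT t:{0..}. I j t * t)"

definition alpha_point :: "(nat \<Rightarrow> real) \<Rightarrow> (nat \<Rightarrow> real \<Rightarrow> real) \<Rightarrow> nat \<Rightarrow> real \<Rightarrow> real" where
  "alpha_point q I j a = (LEAST t. 0 \<le> t \<and> (LBINT s:{0..t}. I j s) \<ge> a * q j)"


section \<open>The RSOS policy\<close>

text \<open>\<open>fifo e x ks b\<close> gives the completion times when the jobs \<open>ks\<close>, listed in queue order with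
  entry times \<open>e\<close> and processing times \<open>x\<close>, are processed on a machine that is free from time \<open>b\<close>.\<close>

fun fifo ::
    "(nat \<Rightarrow> real) \<Rightarrow> (nat \<Rightarrow> real) \<Rightarrow> nat list \<Rightarrow> real \<Rightarrow> nat \<Rightarrow> real" where
  "fifo e x [] b = (\<lambda>_. 0)"
| "fifo e x (k # ks) b = (let C = max b (e k) + x k in (fifo e x ks C)(k := C))"

text \<open>Completion times for fixed draws \<open>a\<close> and realised processing times \<open>x\<close>. For draws in
  \<open>(0,1]\<close> the entry times of distinct jobs are distinct, so the order of the queue is determined.\<close>

definition rsos_completion ::
    "nat \<Rightarrow> (nat \<Rightarrow> real) \<Rightarrow> (nat \<Rightarrow> real \<Rightarrow> real) \<Rightarrow> (nat \<Rightarrow> real) \<Rightarrow> (nat \<Rightarrow> real) \<Rightarrow> nat \<Rightarrow> real" where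
  "rsos_completion n q I a x =
     (let e = (\<lambda>j. alpha_point q I j (a j)) in fifo e x (sort_key e [1..<Suc n]) 0)"


section \<open>Scheduling policies\<close>

text \<open>A policy maps a realisation of the processing times to start times \<open>S\<close>.\<close>

definition feasible_schedule ::
    "nat \<Rightarrow> (nat \<Rightarrow> real) \<Rightarrow> (nat \<Rightarrow> real) \<Rightarrow> (nat \<Rightarrow> real) \<Rightarrow> bool" where
  "feasible_schedule n r x S \<longleftrightarrow>
     (\<forall>j\<in>{1..n}. r j \<le> S j) \<and>
     (\<forall>i\<in>{1..n}. \<forall>j\<in>{1..n}. i \<noteq> j \<longrightarrow> S i + x i \<le> S j \<or> S j + x j \<le> S i)"

definition realisations :: "nat \<Rightarrow> (nat \<Rightarrow> real) set" where
  "realisations n = (\<Pi>\<^sub>E j\<in>{1..n}. {0..})"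

text \<open>Realisation \<open>y\<close> is consistent with what has been observed of the jobs in \<open>J\<close> up to time \<open>t\<close>
  under realisation \<open>x\<close>: the durations of the completed jobs, and that the running ones
  have not yet been completed.\<close>

definition same_history ::
    "nat set \<Rightarrow> (nat \<Rightarrow> real) \<Rightarrow> (nat \<Rightarrow> real) \<Rightarrow> (nat \<Rightarrow> real) \<Rightarrow> real \<Rightarrow> bool" where
  "same_history J S x y t \<longleftrightarrow>
     (\<forall>i\<in>J. (S i + x i \<le> t \<longrightarrow> y i = x i) \<and> (S i < t \<and> t < S i + x i \<longrightarrow> t < S i + y i))"

text \<open>The decision to start \<open>j\<close> at time \<open>t\<close> may only depend on the history of the other jobs up to
  \<open>t\<close>. Job \<open>j\<close> itself is excluded since it would be complete at its start time if \<open>x j = 0\<close>.\<close>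

definition nonanticipative :: "nat \<Rightarrow> ((nat \<Rightarrow> real) \<Rightarrow> nat \<Rightarrow> real) \<Rightarrow> bool" where
  "nonanticipative n \<sigma> \<longleftrightarrow>
     (\<forall>x\<in>realisations n. \<forall>y\<in>realisations n. \<forall>j\<in>{1..n}.
        same_history ({1..n} - {j}) (\<sigma> x) x y (\<sigma> x j) \<longrightarrow> \<sigma> y j = \<sigma> x j)"

text \<open>Policies may be randomised: the first argument of \<open>P\<close> is a seed, drawn uniformly
  from \<open>[0,1]\<close> independently of the processing times.\<close>

definition scheduling_policy ::
    "nat \<Rightarrow> (nat \<Rightarrow> real) \<Rightarrow> (real \<Rightarrow> (nat \<Rightarrow> real) \<Rightarrow> nat \<Rightarrow> real) \<Rightarrow> bool" where
  "scheduling_policy n r P \<longleftrightarrow>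
     (\<forall>j\<in>{1..n}. (\<lambda>(u, x). P u x j) \<in> borel_measurable (borel \<Otimes>\<^sub>M (\<Pi>\<^sub>M i\<in>{1..n}. borel))) \<and>
     (\<forall>u. (\<forall>x\<in>realisations n. feasible_schedule n r x (P u x)) \<and> nonanticipative n (P u))"

definition policy_cost ::
    "'a measure \<Rightarrow> nat \<Rightarrow> (nat \<Rightarrow> real) \<Rightarrow> (nat \<Rightarrow> 'a \<Rightarrow> real) \<Rightarrow>
       (real \<Rightarrow> (nat \<Rightarrow> real) \<Rightarrow> nat \<Rightarrow> real) \<Rightarrow> ennreal" where
  "policy_cost M n w p P =
     (\<integral>\<^sup>+u. \<integral>\<^sup>+\<omega>. ennreal (\<Sum>j=1..n. w j * (P u (\<lambda>i\<in>{1..n}. p i \<omega>) j + p j \<omega>)) \<partial>M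
        \<partial>uniform_measure lborel {0..1})"

definition optimal_policy ::
    "'a measure \<Rightarrow> nat \<Rightarrow> (nat \<Rightarrow> real) \<Rightarrow> (nat \<Rightarrow> real) \<Rightarrow> (nat \<Rightarrow> 'a \<Rightarrow> real) \<Rightarrow>
       (real \<Rightarrow> (nat \<Rightarrow> real) \<Rightarrow> nat \<Rightarrow> real) \<Rightarrow> bool" where
  "optimal_policy M n r w p P \<longleftrightarrow>
     scheduling_policy n r P \<and>
     (\<forall>Q. scheduling_policy n r Q \<longrightarrow> policy_cost M n w p P \<le> policy_cost M n w p Q)"

definition optimal_cost ::
    "'a measure \<Rightarrow> nat \<Rightarrow> (nat \<Rightarrow> real) \<Rightarrow> (nat \<Rightarrow> real) \<Rightarrow> (nat \<Rightarrow> 'a \<Rightarrow> real) \<Rightarrow> ennreal" where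
  "optimal_cost M n r w p = (INF P\<in>{P. scheduling_policy n r P}. policy_cost M n w p P)"

lemma optimal_policy_cost:
  "optimal_policy M n r w p P \<Longrightarrow> policy_cost M n w p P = optimal_cost M n r w p"
  unfolding optimal_policy_def optimal_cost_def
  by (intro antisym INF_greatest INF_lower) auto


section \<open>Existence of the preemptive WSPT schedule\<close>

lemma set_integrable_bounded:
  fixes h :: "real \<Rightarrow> real"
  assumes "h \<in> borel_measurable borel" "\<And>t. 0 \<le> h t" "\<And>t. h t \<le> 1"
  shows "set_integrable lborel {a..b} h"
  unfolding set_integrable_def
  by (rule integrableI_bounded_set_indicator[where B = 1]) (use assms in \<open>auto simp: emeasure_lborel_Icc_eq\<close>)

lemma work_mono:
  fixes h :: "real \<Rightarrow> real"
  assumes "h \<in> borel_measurable borel" "\<And>t. 0 \<le> h t" "\<And>t. h t \<le> 1"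
  shows "mono (\<lambda>t. LBINT s:{0..t}. h s)"
proof (rule monoI)
  fix a b :: real assume "a \<le> b"
  then show "(LBINT s:{0..a}. h s) \<le> (LBINT s:{0..b}. h s)"
    unfolding set_lebesgue_integral_def
    using set_integrable_bounded[OF assms] assms(2)
    by (intro integral_mono) (auto simp: set_integrable_def indicator_def)
qed

lemma work_increment:
  fixes h :: "real \<Rightarrow> real"
  assumes h: "h \<in> borel_measurable borel" "\<And>t. 0 \<le> h t" "\<And>t. h t \<le> 1" and ab: "a \<le> b"
  shows "(LBINT s:{0..b}. h s) \<le> (LBINT s:{0..a}. h s) + (b - a)"
proof -
  have "(LBINT s:{0..b}. h s) \<le> (\<integral>s. indicator {0..a} s *\<^sub>R h s + indicator {a..b} s *\<^sub>R h s \<partial>lborel)"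
    unfolding set_lebesgue_integral_def
    using set_integrable_bounded[OF h] h(2) ab
    by (intro integral_mono) (auto simp: set_integrable_def indicator_def)
  also have "\<dots> = (LBINT s:{0..a}. h s) + (LBINT s:{a..b}. h s)"
    unfolding set_lebesgue_integral_def
    using set_integrable_bounded[OF h]
    by (intro Bochner_Integration.integral_add) (auto simp: set_integrable_def)
  also have "(LBINT s:{a..b}. h s) \<le> (LBINT s:{a..b}. 1)"
    by (intro set_integral_mono set_integrable_bounded h) (auto simp: h(3))
  also have "(LBINT s:{a..b}. 1) = b - a"
    using ab by (simp add: set_lebesgue_integral_def)
  finally show ?thesis by simp
qed

lemma work_continuous:
  fixes h :: "real \<Rightarrow> real"
  assumes h: "h \<in> borel_measurable borel" "\<And>t. 0 \<le> h t" "\<And>t. h t \<le> 1"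
  shows "continuous_on UNIV (\<lambda>t. LBINT s:{0..t}. h s)" (is "continuous_on _ ?F")
proof -
  have "dist (?F a) (?F b) \<le> 1 * dist a b" for a b
    using work_increment[OF h, of a b] work_increment[OF h, of b a]
      monoD[OF work_mono[OF h], of a b] monoD[OF work_mono[OF h], of b a]
    by (cases "a \<le> b") (auto simp: dist_real_def)
  then have "1-lipschitz_on UNIV ?F"
    by (intro lipschitz_onI) auto
  then show ?thesis by (rule lipschitz_on_continuous_on)
qed

lemma work_truncated:
  fixes A :: "real set" and q t :: real
  assumes A: "A \<in> sets borel" and t: "0 \<le> t"
  defines "F \<equiv> \<lambda>t. LBINT s:{0..t}. (indicator A s :: real)"
  shows "(LBINT s:{0..t}. (indicator (A \<inter> {s. F s < q}) s :: real)) < q \<longleftrightarrow> F t < q"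
proof -
  have iA: "(\<lambda>s. indicator A s :: real) \<in> borel_measurable borel" using A by simp
  note bA = iA indicator_pos_le indicator_le_1
  have Feq: "F u = (LBINT s:{0..u}. indicator A s)" for u by (simp add: F_def)
  have Fmono: "mono F" unfolding F_def by (rule work_mono[OF bA])
  have Fcont: "continuous_on UNIV F" unfolding F_def by (rule work_continuous[OF bA])
  have "F \<in> borel_measurable borel" by (rule borel_measurable_mono[OF Fmono])
  then have "Measurable.pred borel (\<lambda>s. F s < q)" by measurable
  then have "{s. F s < q} \<in> sets borel" by (simp add: pred_def)
  with A have "A \<inter> {s. F s < q} \<in> sets borel" by auto
  then have iB: "(\<lambda>s. indicator (A \<inter> {s. F s < q}) s :: real) \<in> borel_measurable borel" by simp
  note bB = iB indicator_pos_le indicator_le_1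
  let ?G = "\<lambda>t. LBINT s:{0..t}. (indicator (A \<inter> {s. F s < q}) s :: real)"
  show ?thesis
  proof (cases "F t < q")
    case True
    have "F s < q" if "s \<le> t" for s
      using monoD[OF Fmono that] True by simp
    then have "?G t = F t"
      unfolding Feq[of t]
      by (intro set_lebesgue_integral_cong) (auto simp: indicator_def)
    with True show ?thesis by simp
  next
    case False
    let ?K = "{0..t} \<inter> F -` {q..}"
    have "closed (F -` {q..})"
      using Fcont by (simp add: closed_vimage continuous_on_closed_vimage)
    then have "compact ?K" by (rule compact_Int_closed[OF compact_Icc])
    moreover have "?K \<noteq> {}" using False t by auto
    ultimately obtain T where T: "T \<in> ?K" "\<And>s. s \<in> ?K \<Longrightarrow> T \<le> s"
      using compact_attains_inf[of ?K] by blast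
    have less: "F s < q" if "0 \<le> s" "s < T" for s
      using T(1) T(2)[of s] that by force
    have "AE s in lborel. s \<noteq> T" by (rule AE_lborel_singleton)
    then have "?G T = F T"
      unfolding Feq[of T] set_lebesgue_integral_def
      using A iB less
      by (intro integral_cong_AE) (auto simp: indicator_def elim!: eventually_mono)
    moreover have "?G T \<le> ?G t"
      using work_mono[OF bB] T(1) by (auto dest: monoD)
    ultimately show ?thesis using T(1) False by auto
  qed
qed

lemma preemptive_wspt_exists: "\<exists>I. preemptive_wspt n r q I"
proof -
  have "\<exists>I. preemptive_wspt n r q I \<and>
          (\<forall>j. I j \<in> borel_measurable borel \<and> (\<forall>t. 0 \<le> I j t \<and> I j t \<le> 1))"
  proof (induction n)
    case 0
    show ?case
      by (rule exI[of _ "\<lambda>_ _. 0"]) (simp add: preemptive_wspt_def)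
  next
    case (Suc n)
    then obtain I where I: "preemptive_wspt n r q I"
      and bI: "\<And>j. I j \<in> borel_measurable borel" "\<And>j t. 0 \<le> I j t" "\<And>j t. I j t \<le> 1"
      by blast
    have "(\<lambda>t. LBINT s:{0..t}. I j s) \<in> borel_measurable borel" for j
      by (rule borel_measurable_mono[OF work_mono[OF bI]])
    then have [measurable]: "Measurable.pred borel (pending r q I j)" for j
      unfolding pending_def by measurable
    define A where "A = {t. r (Suc n) \<le> t \<and> (\<forall>i\<in>{1..<Suc n}. \<not> pending r q I i t)}"
    have "Measurable.pred borel (\<lambda>t. r (Suc n) \<le> t \<and> (\<forall>i\<in>{1..<Suc n}. \<not> pending r q I i t))"
      by measurable
    then have A: "A \<in> sets borel" by (simp add: A_def pred_def)
    define F where "F = (\<lambda>t. LBINT s:{0..t}. (indicator A s :: real))"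
    have "F \<in> borel_measurable borel"
      unfolding F_def by (rule borel_measurable_mono[OF work_mono]) (use A in auto)
    then have "Measurable.pred borel (\<lambda>s. F s < q (Suc n))" by measurable
    then have "{s. F s < q (Suc n)} \<in> sets borel" by (simp add: pred_def)
    with A have B: "A \<inter> {s. F s < q (Suc n)} \<in> sets borel" by auto
    define I' where "I' = I (Suc n := (\<lambda>t. indicator (A \<inter> {s. F s < q (Suc n)}) t))"
    have old: "pending r q I' j t \<longleftrightarrow> pending r q I j t" if "j \<noteq> Suc n" for j t
      using that by (simp add: pending_def I'_def)
    have new: "pending r q I' (Suc n) t \<longleftrightarrow> r (Suc n) \<le> t \<and> F t < q (Suc n)" if "0 \<le> t" for t
      using work_truncated[OF A that, of "q (Suc n)"] by (simp add: pending_def I'_def F_def)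
    have "preemptive_wspt (Suc n) r q I'"
      unfolding preemptive_wspt_def
    proof (intro allI impI ballI)
      fix t :: real and j assume t: "0 \<le> t" and j: "j \<in> {1..Suc n}"
      show "I' j t =
        (if pending r q I' j t \<and> (\<forall>i\<in>{1..<j}. \<not> pending r q I' i t) then 1 else 0)"
      proof (cases "j = Suc n")
        case True
        have "(\<forall>i\<in>{1..<j}. \<not> pending r q I' i t) \<longleftrightarrow> (\<forall>i\<in>{1..<Suc n}. \<not> pending r q I i t)"
          using True old by auto
        moreover have "I' j t = (if t \<in> A \<and> F t < q (Suc n) then 1 else 0)"
          using True by (auto simp: I'_def indicator_def)
        ultimately show ?thesis using new[OF t] True by (auto simp: A_def)
      next
        case False
        then have j': "j \<in> {1..n}" using j by auto
        then have "(\<forall>i\<in>{1..<j}. \<not> pending r q I' i t) \<longleftrightarrow> (\<forall>i\<in>{1..<j}. \<not> pending r q I i t)"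
          using old by auto
        moreover have "I' j t = I j t" using False by (simp add: I'_def)
        ultimately show ?thesis
          using I t j' False old[of j t] unfolding preemptive_wspt_def by metis
      qed
    qed
    moreover have "I' j \<in> borel_measurable borel \<and> (\<forall>t. 0 \<le> I' j t \<and> I' j t \<le> 1)" for j
      using bI B by (simp add: I'_def)
    ultimately show ?case by blast
  qed
  then show ?thesis by blast
qed

end

theory Submission
  imports Defs
begin

text \<open>
  Upper bound. Given the draws, let \<open>e\<^sub>k\<close> be the time job \<open>k\<close> enters the queue. Between \<open>e\<^sub>k\<close> and
  \<open>e\<^sub>j\<close> the preemptive schedule spends \<open>(\<eta>\<^sub>k - \<alpha>\<^sub>k) q\<^sub>k\<close> on \<open>k\<close>, where \<open>\<eta>\<^sub>k\<close> is the fraction of \<open>k\<close>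
  done by \<open>e\<^sub>j\<close>, so \<open>k\<close> delays \<open>j\<close> by at most \<open>(p\<^sub>k - (\<eta>\<^sub>k - \<alpha>\<^sub>k) q\<^sub>k)\<^sup>+\<close>, whose mean is at most
  \<open>(1 - g(\<Delta>) (\<eta>\<^sub>k - \<alpha>\<^sub>k)) q\<^sub>k\<close>. While \<open>j\<close> is pending only jobs \<open>k \<le> j\<close> run, and whenever \<open>j\<close> runs every
  \<open>k < j\<close> is either unreleased or complete; hence \<open>C\<^sub>j(a) = d + a q\<^sub>j + \<Sum>\<^bsub>k<j\<^esub> \<eta>\<^sub>k q\<^sub>k\<close> with \<open>\<eta>\<^sub>k \<in> {0, 1}\<close>
  and \<open>d\<close> independent of \<open>a\<close>. Condition (1) bounds the delay caused by the jobs \<open>k > j\<close>, which have received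
  at most \<open>d\<close> in total; condition (2) bounds the contribution of each \<open>k < j\<close>.

  Lower bound. By Abel summation over the WSPT order it suffices to compare the start times of
  \<open>{1..k}\<close>, weighted by \<open>q\<close>, for every \<open>k\<close>. The preemptive schedule of \<open>{1..k}\<close> splits into busy periods, no
  job of a busy period is released before it begins, and non-overlap bounds
  \<open>\<Sum> p\<^sub>i S\<^sub>i\<close> over the jobs of a period in terms of products \<open>p\<^sub>i p\<^sub>l\<close> of distinct jobs. Since \<open>S\<^sub>i\<close> does
  not depend on \<open>p\<^sub>i\<close>, taking expectations replaces every \<open>p\<^sub>i\<close> by \<open>q\<^sub>i\<close>.
\<close>

section \<open>The preemptive WSPT schedule\<close>

lemma work_diff:
  fixes h :: "real \<Rightarrow> real"
  assumes h: "h \<in> borel_measurable borel" "\<And>t. 0 \<le> h t" "\<And>t. h t \<le> 1"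
    and ab: "0 \<le> a" "a \<le> b"
  shows "(LBINT s:{0..b}. h s) - (LBINT s:{0..a}. h s) = (LBINT s:{a<..b}. h s)"
proof -
  have "{0..b} = {0..a} \<union> {a<..b}" using ab by auto
  moreover have "set_integrable lborel {a<..b} h"
    by (rule set_integrable_subset[OF set_integrable_bounded[OF h, of a b]]) auto
  ultimately show ?thesis
    using set_integrable_bounded[OF h, of 0 a] by (subst (1) \<open>{0..b} = _\<close>, subst set_integral_Un) auto
qed

text \<open>Symmetrise over the square: \<open>h(s) h(t)\<close> with \<open>s \<le> t\<close> covers half of the total mass.\<close>

lemma integral_times_work:
  fixes h :: "real \<Rightarrow> real"
  assumes h: "h \<in> borel_measurable borel" "\<And>t. 0 \<le> h t" "\<And>t. h t \<le> 1"
    and supp: "\<And>t. t < 0 \<or> T < t \<Longrightarrow> h t = 0"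
  shows "(\<integral>t. h t * (LBINT s:{0..t}. h s) \<partial>lborel) = (\<integral>t. h t \<partial>lborel)\<^sup>2 / 2"
proof -
  note [measurable] = h(1)
  have h_supp: "indicator {0..T} t * h t = h t" for t
    using supp[of t] by (cases "t < 0 \<or> T < t") (auto simp: indicator_def)
  have int: "integrable lborel h"
    using set_integrable_bounded[OF h, of 0 T] by (simp add: set_integrable_def h_supp)
  have W: "(LBINT s:{0..t}. h s) = (\<integral>s. indicator {..t} s * h s \<partial>lborel)" for t
    unfolding set_lebesgue_integral_def
    by (intro Bochner_Integration.integral_cong) (auto simp: indicator_def supp)
  have int2: "integrable (lborel \<Otimes>\<^sub>M lborel) (\<lambda>(t, s). h t * h s)"
    by (intro lborel_pair.Fubini_integrable) (auto simp: int h(2) abs_mult)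
  have intl: "integrable (lborel \<Otimes>\<^sub>M lborel) (\<lambda>(t, s). h t * (indicator {..t} s * h s))"
    by (rule Bochner_Integration.integrable_bound[OF int2])
       (auto simp: indicator_def h(2) split_beta' intro!: AE_I2)
  have intu: "integrable (lborel \<Otimes>\<^sub>M lborel) (\<lambda>(s, t). h t * (indicator {..t} s * h s))"
    by (rule Bochner_Integration.integrable_bound[OF int2])
       (auto simp: indicator_def h(2) split_beta' intro!: AE_I2)
  have intu': "integrable (lborel \<Otimes>\<^sub>M lborel) (\<lambda>(t, s). h s * (indicator {..s} t * h t))"
    using lborel_pair.integrable_product_swap[OF intl] by (simp add: split_beta')
  define L where "L = (\<integral>t. \<integral>s. h t * (indicator {..t} s * h s) \<partial>lborel \<partial>lborel)"
  have i1: "integrable lborel (\<lambda>s. h t * (indicator {..t} s * h s))" for t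
    by (intro integrable_mult_right Bochner_Integration.integrable_bound[OF int])
       (auto simp: indicator_def h(2) intro!: AE_I2)
  have i2: "integrable lborel (\<lambda>s. h s * (indicator {..s} t * h t))" for t
    by (rule Bochner_Integration.integrable_bound[OF integrable_mult_right[OF int, of "h t"]])
       (auto simp: indicator_def h(2) intro!: AE_I2)
  have "L = (\<integral>t. \<integral>s. h s * (indicator {..s} t * h t) \<partial>lborel \<partial>lborel)"
    unfolding L_def using lborel_pair.Fubini_integral[OF intu] by simp
  then have "L + L = (\<integral>t. (\<integral>s. h t * (indicator {..t} s * h s) \<partial>lborel)
      + (\<integral>s. h s * (indicator {..s} t * h t) \<partial>lborel) \<partial>lborel)"
    using lborel_pair.integrable_fst'[OF intl] lborel_pair.integrable_fst'[OF intu']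
    by (subst Bochner_Integration.integral_add) (auto simp: L_def)
  also have "\<dots> = (\<integral>t. (\<integral>s. h t * h s \<partial>lborel) \<partial>lborel)"
  proof (intro Bochner_Integration.integral_cong refl)
    fix t :: real
    \<comment> \<open>Both half-squares contain the diagonal, which is counted twice but is a null
      set.\<close>
    have "AE s in lborel. s \<noteq> t" by (rule AE_lborel_singleton)
    then have "(\<integral>s. h t * (indicator {..t} s * h s) + h s * (indicator {..s} t * h t) \<partial>lborel)
        = (\<integral>s. h t * h s \<partial>lborel)"
      by (intro integral_cong_AE) (auto simp: indicator_def elim!: eventually_mono)
    then show "(\<integral>s. h t * (indicator {..t} s * h s) \<partial>lborel)
      + (\<integral>s. h s * (indicator {..s} t * h t) \<partial>lborel) = (\<integral>s. h t * h s \<partial>lborel)"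
      using i1 i2 by simp
  qed
  also have "\<dots> = (\<integral>t. h t \<partial>lborel)\<^sup>2"
    by (simp add: power2_eq_square)
  finally show ?thesis
    unfolding W L_def by simp
qed

locale wspt_schedule =
  fixes n :: nat and r q :: "nat \<Rightarrow> real" and I :: "nat \<Rightarrow> real \<Rightarrow> real"
  assumes wspt: "preemptive_wspt n r q I"
    and release_nonneg: "j \<in> {1..n} \<Longrightarrow> 0 \<le> r j"
    and q_pos: "j \<in> {1..n} \<Longrightarrow> 0 < q j"
begin

text \<open>\<open>preemptive_wspt\<close> says nothing about negative times or about indices
  outside \<open>{1..n}\<close>. The value 0 there makes the bounds \<open>run_nonneg\<close> and
  \<open>run_le_1\<close> unconditional and lets integrals range over the whole line.\<close>

definition run :: "nat \<Rightarrow> real \<Rightarrow> real" where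
  "run j t = (if 0 \<le> t \<and> j \<in> {1..n} then I j t else 0)"

definition work :: "nat \<Rightarrow> real \<Rightarrow> real" where
  "work j t = (LBINT s:{0..t}. run j s)"

definition pend :: "nat \<Rightarrow> real \<Rightarrow> bool" where
  "pend j t \<longleftrightarrow> r j \<le> t \<and> work j t < q j"

lemma work_eq: "j \<in> {1..n} \<Longrightarrow> work j t = (LBINT s:{0..t}. I j s)"
  unfolding work_def by (rule set_lebesgue_integral_cong) (auto simp: run_def)

lemma run_eq:
  assumes "j \<in> {1..n}" "0 \<le> t"
  shows "run j t = (if pend j t \<and> (\<forall>i\<in>{1..<j}. \<not> pend i t) then 1 else 0)"
proof -
  have "pending r q I i t \<longleftrightarrow> pend i t" if "i \<in> {1..n}" for i
    using that by (simp add: pending_def pend_def work_eq)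
  then show ?thesis
    using wspt assms unfolding preemptive_wspt_def by (auto simp: run_def)
qed

lemma run_nonneg: "0 \<le> run j t" and run_le_1: "run j t \<le> 1"
  using run_eq[of j t] by (auto simp: run_def)

text \<open>Where \<open>run j\<close> fails to be integrable up to \<open>t\<close>, \<open>work j t\<close> has the junk value 0, so job \<open>j\<close>
  counts as unfinished; hence the schedule cannot actually be non-measurable.\<close>

lemma run_measurable [measurable]: "run j \<in> borel_measurable borel"
proof (induction j rule: less_induct)
  case (less j)
  show ?case
  proof (cases "j \<in> {1..n}")
    case False
    then have "run j = (\<lambda>_. 0)" by (auto simp: run_def fun_eq_iff)
    then show ?thesis by simp
  next
    case True
    have [measurable]: "work i \<in> borel_measurable borel" if "i \<in> {1..<j}" for i
      using that less[of i] unfolding work_def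
      by (intro borel_measurable_mono[OF work_mono]) (auto simp: run_nonneg run_le_1)
    define A where "A = {t. 0 \<le> t \<and> r j \<le> t \<and> (\<forall>i\<in>{1..<j}. \<not> pend i t)}"
    have [measurable]: "Measurable.pred borel (pend i)" if "i \<in> {1..<j}" for i
      using that unfolding pend_def by measurable
    have "Measurable.pred borel (\<lambda>t. 0 \<le> t \<and> r j \<le> t \<and> (\<forall>i\<in>{1..<j}. \<not> pend i t))"
      by measurable
    then have A [measurable]: "A \<in> sets borel" by (simp add: A_def pred_def)
    \<comment> \<open>Before measurability is known, \<open>run j\<close> might be integrable only
      up to some time. \<open>G\<close> collects the times up to which it is; with each time it
      contains all earlier nonnegative ones.\<close>
    define G where "G = {t. 0 \<le> t \<and> set_integrable lborel {0..t} (run j)}"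
    have G_down: "s \<in> G" if "t \<in> G" "0 \<le> s" "s \<le> t" for s t
      using that by (auto simp: G_def intro: set_integrable_subset)
    \<comment> \<open>Beyond \<open>G\<close> the integral drops to its default value 0. Capping by
      \<open>q j\<close> inside \<open>G\<close> and continuing with \<open>q j\<close> beyond it
      yields a monotone, hence Borel, substitute for \<open>work j\<close>.\<close>
    define F where "F t = (if t < 0 then 0 else if t \<in> G then min (work j t) (q j) else q j)" for t
    have work_nonneg: "0 \<le> work j t" for t
      unfolding work_def set_lebesgue_integral_def
      by (intro integral_nonneg_AE) (auto simp: run_nonneg)
    have work_mono': "work j s \<le> work j t" if "t \<in> G" "0 \<le> s" "s \<le> t" for s t
      using that G_down[OF that] unfolding work_def set_lebesgue_integral_def
      by (intro integral_mono) (auto simp: G_def set_integrable_def indicator_def run_nonneg)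
    have "mono F"
    proof (rule monoI)
      fix s t :: real assume "s \<le> t"
      then show "F s \<le> F t"
        using work_mono'[of t s] work_nonneg q_pos[OF True] G_down[of t s]
        unfolding F_def by (auto simp: min_def)
    qed
    then have [measurable]: "F \<in> borel_measurable borel" by (rule borel_measurable_mono)
    have "mono (\<lambda>t. if t \<in> G \<or> t < 0 then 0 else (1::real))"
      using G_down by (intro monoI) (auto simp: G_def not_less)
    then have [measurable]: "(\<lambda>t. if t \<in> G \<or> t < 0 then 0 else (1::real)) \<in> borel_measurable borel"
      by (rule borel_measurable_mono)
    have junk: "work j t = 0" if "t \<notin> G" "0 \<le> t" for t
      using that unfolding work_def set_lebesgue_integral_def G_def set_integrable_def
      by (simp add: not_integrable_integral_eq)
    \<comment> \<open>Outside \<open>G\<close> the default value 0 is below \<open>q j\<close>, so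
      only the release and the jobs of smaller index matter; inside \<open>G\<close> the cap does
      not change the comparison with \<open>q j\<close>. Either way the condition is Borel.\<close>
    have "run j t = indicator A t *
      (if (if t \<in> G \<or> t < 0 then 0 else (1::real)) = 1 \<or> F t < q j then 1 else 0)" for t
    proof (cases "0 \<le> t")
      case False
      then show ?thesis by (simp add: run_def A_def)
    next
      case nn: True
      then show ?thesis
        using run_eq[OF True nn] junk[of t] q_pos[OF True]
        by (auto simp: A_def F_def pend_def indicator_def min_def)
    qed
    then have "run j = (\<lambda>t. indicator A t *
      (if (if t \<in> G \<or> t < 0 then 0 else (1::real)) = 1 \<or> F t < q j then 1 else 0))" by blast
    also have "\<dots> \<in> borel_measurable borel" by measurable
    finally show ?thesis .
  qed
qed

section \<open>Work functions: integrability, monotonicity, continuity and increments\<close>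

lemma integrable_run_Icc: "set_integrable lborel {a..b} (run j)"
  by (rule set_integrable_bounded[OF run_measurable run_nonneg run_le_1])

lemma integrable_run_Ioc: "set_integrable lborel {a<..b} (run j)"
  by (rule set_integrable_subset[OF integrable_run_Icc[of a b]]) auto

lemma work_mono_time: "s \<le> t \<Longrightarrow> work j s \<le> work j t"
  unfolding work_def using work_mono[OF run_measurable run_nonneg run_le_1] by (rule monoD)

lemma work_measurable [measurable]: "work j \<in> borel_measurable borel"
  by (rule borel_measurable_mono) (simp add: monoI work_mono_time)

lemma work_continuous_on: "continuous_on A (work j)"
  unfolding work_def
  by (rule continuous_on_subset[OF work_continuous[OF run_measurable run_nonneg run_le_1]]) auto

lemma work_0: "t \<le> 0 \<Longrightarrow> work j t = 0"
proof (cases "t = 0")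
  case True
  have "AE s in lborel. s \<noteq> (0::real)" by (rule AE_lborel_singleton)
  then have "AE s in lborel. indicator {0..0} s *\<^sub>R run j s = 0"
    by (rule eventually_mono) auto
  then have "(LBINT s:{0..0}. run j s) = 0"
    unfolding set_lebesgue_integral_def by (rule integral_eq_zero_AE)
  then show ?thesis using True by (simp add: work_def)
qed (simp add: work_def set_lebesgue_integral_def)

lemma work_nonneg: "0 \<le> work j t"
  using work_0[of "min t 0" j] work_mono_time[of "min t 0" t j] by simp

lemma work_increment_eq:
  assumes "0 \<le> s" "s \<le> t"
  shows "work j t - work j s = (LBINT u:{s<..t}. run j u)"
  unfolding work_def by (rule work_diff[OF run_measurable run_nonneg run_le_1 assms])

lemma sum_work_increment_eq:
  assumes "0 \<le> s" "s \<le> t" "finite A"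
  shows "(\<Sum>j\<in>A. work j t) - (\<Sum>j\<in>A. work j s) = (LBINT u:{s<..t}. (\<Sum>j\<in>A. run j u))"
proof -
  have "(\<Sum>j\<in>A. work j t) - (\<Sum>j\<in>A. work j s) = (\<Sum>j\<in>A. LBINT u:{s<..t}. run j u)"
    by (simp add: sum_subtractf[symmetric] work_increment_eq[OF assms(1,2)])
  also have "\<dots> = (LBINT u:{s<..t}. (\<Sum>j\<in>A. run j u))"
    using integrable_run_Ioc[of s t] unfolding set_lebesgue_integral_def set_integrable_def
    by (simp add: scaleR_right.sum sum_distrib_left)
  finally show ?thesis .
qed

lemma work_const:
  assumes "s \<le> t" "\<And>u. s < u \<Longrightarrow> u < t \<Longrightarrow> run j u = 0"
  shows "work j t = work j s"
proof -
  have *: "work j t = work j s" if "0 \<le> s" "s \<le> t" "\<And>u. s < u \<Longrightarrow> u < t \<Longrightarrow> run j u = 0" for s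
  proof -
    have "AE u in lborel. u \<noteq> t" by (rule AE_lborel_singleton)
    then have "(LBINT u:{s<..t}. run j u) = (\<integral>u. 0 \<partial>(lborel :: real measure))"
      unfolding set_lebesgue_integral_def using that
      by (intro integral_cong_AE) (auto simp: indicator_def elim!: eventually_mono)
    then show ?thesis using work_increment_eq[OF that(1,2), of j] by simp
  qed
  show ?thesis
  proof (cases "0 \<le> s")
    case True
    then show ?thesis using * assms by blast
  next
    case False
    then show ?thesis
      using *[of 0] assms work_0[of s j] work_0[of 0 j] work_0[of t j] by (cases "0 \<le> t") auto
  qed
qed

section \<open>Consequences of the priority rule for the work received\<close>

lemma run_zero_not_pend: "\<not> pend j t \<Longrightarrow> run j t = 0"
  using run_eq[of j t] by (auto simp: run_def)

lemma work_before_release: "t \<le> r j \<Longrightarrow> work j t = 0"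
  using work_const[of "min 0 t" t j] work_0[of "min 0 t" j]
    run_zero_not_pend[of j] by (auto simp: pend_def)

text \<open>Otherwise the continuous function \<open>work j\<close> would take the value
  \<open>q j\<close> at some earlier time, after which \<open>j\<close> is no longer pending and
  receives nothing more.\<close>

lemma work_le:
  assumes j: "j \<in> {1..n}"
  shows "work j t \<le> q j"
proof (rule ccontr)
  assume *: "\<not> work j t \<le> q j"
  then have "0 \<le> t" using work_0[of t j] q_pos[OF j] by (cases "0 \<le> t") auto
  moreover have "work j 0 \<le> q j" using work_0[of 0 j] q_pos[OF j] by simp
  ultimately obtain s where s: "0 \<le> s" "s \<le> t" "work j s = q j"
    using IVT'[of "work j" 0 "q j" t] * work_continuous_on by (auto simp: not_le)
  have "work j t = work j s"
  proof (rule work_const)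
    fix u assume "s < u" "u < t"
    then show "run j u = 0"
      using work_mono_time[of s u j] s by (intro run_zero_not_pend) (auto simp: pend_def)
  qed (use s in auto)
  then show False using s * by simp
qed

text \<open>Of the pending jobs in a prefix of the indices exactly the smallest one runs, and jobs
  of larger index never interfere. Each prefix therefore acts like one job that is served whenever
  it is present; this is what makes prefixes the right unit for both bounds.\<close>

lemma sum_run_prefix:
  assumes "k \<le> n" "0 \<le> t"
  shows "(\<Sum>j=1..k. run j t) = (if \<exists>j\<in>{1..k}. pend j t then 1 else 0)"
  using assms(1)
proof (induction k)
  case 0
  then show ?case by simp
next
  case (Suc k)
  have "run (Suc k) t = (if pend (Suc k) t \<and> \<not> (\<exists>j\<in>{1..k}. pend j t) then 1 else 0)"
    using Suc.prems run_eq[OF _ assms(2), of "Suc k"] by (auto simp: less_Suc_eq_le)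
  moreover have "{1..Suc k} = insert (Suc k) {1..k}" by auto
  ultimately show ?case using Suc by auto
qed

lemma sum_run_le_1:
  assumes "A \<subseteq> {1..n}"
  shows "(\<Sum>j\<in>A. run j t) \<le> 1"
proof (cases "0 \<le> t")
  case True
  have "(\<Sum>j\<in>A. run j t) \<le> (\<Sum>j=1..n. run j t)"
    using assms by (intro sum_mono2) (auto simp: run_nonneg)
  also have "\<dots> \<le> 1" using sum_run_prefix[OF _ True, of n] by simp
  finally show ?thesis .
qed (simp add: run_def)

lemma sum_work_increment_le:
  assumes "A \<subseteq> {1..n}" "0 \<le> s" "s \<le> t"
  shows "(\<Sum>j\<in>A. work j t) - (\<Sum>j\<in>A. work j s) \<le> t - s"
proof -
  have fin: "finite A" using assms finite_subset by blast
  have "(LBINT u:{s<..t}. (\<Sum>j\<in>A. run j u)) \<le> (LBINT u:{s<..t}. 1)"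
    using integrable_run_Ioc[of s t] sum_run_le_1[OF assms(1)] assms(3)
    by (intro set_integral_mono)
       (auto simp: set_integrable_def sum_distrib_left intro!: integrable_real_indicator)
  also have "\<dots> = t - s" using assms by (simp add: set_lebesgue_integral_def)
  finally show ?thesis using sum_work_increment_eq[OF assms(2,3) fin] by simp
qed

lemma sum_work_le: "A \<subseteq> {1..n} \<Longrightarrow> 0 \<le> t \<Longrightarrow> (\<Sum>j\<in>A. work j t) \<le> t"
  using sum_work_increment_le[of A 0 t] work_0[of 0] by simp

lemma sum_work_busy:
  assumes k: "k \<le> n" and st: "0 \<le> s" "s \<le> t"
    and busy: "\<And>u. s \<le> u \<Longrightarrow> u < t \<Longrightarrow> \<exists>j\<in>{1..k}. pend j u"
  shows "(\<Sum>j=1..k. work j t) - (\<Sum>j=1..k. work j s) = t - s"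
proof -
  have "AE u in lborel. u \<noteq> t" by (rule AE_lborel_singleton)
  moreover have "(\<Sum>j=1..k. run j u) = 1" if "s < u" "u \<le> t" "u \<noteq> t" for u
    using sum_run_prefix[OF k, of u] st busy[of u] that by auto
  ultimately have "(LBINT u:{s<..t}. (\<Sum>j=1..k. run j u)) = (\<integral>u. indicator {s<..t} u \<partial>lborel)"
    unfolding set_lebesgue_integral_def
    by (intro integral_cong_AE) (auto simp: indicator_def elim!: eventually_mono)
  then show ?thesis using st sum_work_increment_eq[OF st, of "{1..k}"] by simp
qed

section \<open>Idle time of a prefix and the horizon of the schedule\<close>

lemma pend_earlier:
  assumes "pend j t" "r j \<le> s" "s \<le> t"
  shows "pend j s"
  using assms work_mono_time[of s t j] by (auto simp: pend_def)

text \<open>For \<open>t \<ge> 0\<close>, the time up to \<open>t\<close> that is not spent on the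
  jobs \<open>{1..k}\<close>, whether the machine rests or serves jobs of larger index. It stays
  constant through a busy period of the prefix and so can label that period.\<close>

definition idle :: "nat \<Rightarrow> real \<Rightarrow> real" where
  "idle k t = t - (\<Sum>j=1..k. work j t)"

lemma idle_mono:
  assumes "k \<le> n" "0 \<le> s" "s \<le> t"
  shows "idle k s \<le> idle k t"
  using sum_work_increment_le[of "{1..k}" s t] assms by (auto simp: idle_def)

text \<open>A pending job of the prefix keeps the machine on the prefix, so no idle time accrues
  from its release on.\<close>

lemma idle_pend:
  assumes "j \<in> {1..k}" "k \<le> n" "r j \<le> t" "\<And>u. r j \<le> u \<Longrightarrow> u < t \<Longrightarrow> pend j u"
  shows "idle k t = idle k (r j)"
  using sum_work_busy[of k "r j" t] assms release_nonneg[of j] by (force simp: idle_def)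

lemma idle_run:
  assumes "j \<in> {1..k}" "k \<le> n" "run j t \<noteq> 0"
  shows "idle k t = idle k (r j)"
proof -
  have "pend j t" using assms run_zero_not_pend by blast
  then show ?thesis using assms pend_earlier[of j t]
    by (intro idle_pend) (auto simp: pend_def)
qed

text \<open>The sum of the release dates is a time by which every job is released, and the sum of
  the \<open>q j\<close> is all the work there is. The extra 1 gives the strict inequality in
  \<open>work_horizon\<close> and positivity even without jobs.\<close>

definition horizon :: real where
  "horizon = (\<Sum>j=1..n. r j) + (\<Sum>j=1..n. q j) + 1"

text \<open>An unfinished job would keep the machine busy from the time when everything is released,
  and more work would be done than exists.\<close>

lemma work_horizon:
  assumes j: "j \<in> {1..n}" and t: "horizon \<le> t"
  shows "work j t = q j"
proof (rule ccontr)
  assume "work j t \<noteq> q j"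
  then have lt: "work j t < q j" using work_le[OF j, of t] by simp
  define R where "R = (\<Sum>j=1..n. r j)"
  have rR: "r j \<le> R" unfolding R_def
    using j release_nonneg by (intro member_le_sum) auto
  have R0: "0 \<le> R" unfolding R_def using release_nonneg by (intro sum_nonneg) auto
  have Q0: "0 \<le> (\<Sum>j=1..n. q j)" using q_pos by (intro sum_nonneg) (auto simp: less_imp_le)
  have "(\<Sum>j=1..n. work j t) - (\<Sum>j=1..n. work j R) = t - R"
  proof (rule sum_work_busy)
    fix u assume "R \<le> u" "u < t"
    then have "pend j u" using lt rR work_mono_time[of u t j] by (auto simp: pend_def)
    then show "\<exists>j\<in>{1..n}. pend j u" using j by blast
  qed (use R0 t Q0 in \<open>auto simp: horizon_def R_def\<close>)
  moreover have "(\<Sum>j=1..n. work j t) \<le> (\<Sum>j=1..n. q j)"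
    by (intro sum_mono work_le) auto
  moreover have "0 \<le> (\<Sum>j=1..n. work j R)"
    by (intro sum_nonneg work_nonneg)
  ultimately show False using t by (simp add: horizon_def R_def)
qed

lemma horizon_pos: "0 < horizon"
proof -
  have "0 \<le> (\<Sum>j=1..n. r j)" "0 \<le> (\<Sum>j=1..n. q j)"
    using release_nonneg q_pos by (auto intro!: sum_nonneg simp: less_imp_le)
  then show ?thesis by (simp add: horizon_def)
qed

lemma run_outside: "t < 0 \<or> horizon < t \<Longrightarrow> run j t = 0"
proof (cases "j \<in> {1..n} \<and> 0 \<le> t")
  case True
  moreover assume "t < 0 \<or> horizon < t"
  ultimately have "work j t = q j" by (intro work_horizon) auto
  then show ?thesis by (intro run_zero_not_pend) (simp add: pend_def)
qed (auto simp: run_def)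

section \<open>Integrals over the schedule and mean busy times\<close>

lemma integrable_run [simp]: "integrable lborel (run j)"
proof -
  have "integrable lborel (\<lambda>t. indicator {0..horizon} t *\<^sub>R run j t)"
    using integrable_run_Icc[of 0 horizon j]
    by (simp add: set_integrable_def)
  moreover have "indicator {0..horizon} t *\<^sub>R run j t = run j t" for t
    using run_outside[of t j] by (cases "t < 0 \<or> horizon < t") (auto simp: indicator_def)
  ultimately show ?thesis by (simp only:)
qed

lemma integrable_run_mult:
  assumes [measurable]: "h \<in> borel_measurable borel"
    and "\<And>t. 0 \<le> t \<Longrightarrow> t \<le> horizon \<Longrightarrow> \<bar>h t\<bar> \<le> B"
  shows "integrable lborel (\<lambda>t. run j t * h t)"
proof (rule Bochner_Integration.integrable_bound)
  show "integrable lborel (\<lambda>t. B * run j t)" by simp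
  show "AE t in lborel. norm (run j t * h t) \<le> norm (B * run j t)"
  proof (rule AE_I2)
    fix t
    have "\<bar>h t\<bar> * run j t \<le> B * run j t"
    proof (cases "t < 0 \<or> horizon < t")
      case True
      then show ?thesis using run_outside[of t j] by simp
    next
      case False
      then show ?thesis using assms(2)[of t] run_nonneg[of j t] by (intro mult_right_mono) auto
    qed
    also have "\<dots> \<le> \<bar>B * run j t\<bar>" by simp
    finally show "norm (run j t * h t) \<le> norm (B * run j t)"
      using run_nonneg[of j t] by (simp add: abs_mult mult.commute)
  qed
qed simp

lemma integral_run_after:
  assumes "j \<in> {1..n}" "0 \<le> s"
  shows "(\<integral>t. indicator {s<..} t * run j t \<partial>lborel) = q j - work j s"
proof -
  have "(\<integral>t. indicator {s<..} t * run j t \<partial>lborel) = (LBINT t:{s<..max s horizon}. run j t)"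
    unfolding set_lebesgue_integral_def
  proof (intro Bochner_Integration.integral_cong refl)
    fix t show "indicator {s<..} t * run j t = indicator {s<..max s horizon} t *\<^sub>R run j t"
      using run_outside[of t j] by (auto simp: indicator_def not_le)
  qed
  then show ?thesis
    using work_increment_eq[of s "max s horizon" j] work_horizon[of j "max s horizon"] assms by simp
qed

lemma integral_run:
  assumes "j \<in> {1..n}"
  shows "(\<integral>t. run j t \<partial>lborel) = q j"
proof -
  have "AE t in lborel. t \<noteq> (0::real)" by (rule AE_lborel_singleton)
  then have "(\<integral>t. run j t \<partial>lborel) = (\<integral>t. indicator {0<..} t * run j t \<partial>lborel)"
    using run_outside[of _ j]
    by (intro integral_cong_AE) (auto simp: indicator_def not_less elim!: eventually_mono)
  then show ?thesis using integral_run_after[OF assms, of 0] work_0[of 0 j] by simp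
qed

definition busy_moment :: "nat \<Rightarrow> real" where
  "busy_moment j = (\<integral>t. run j t * t \<partial>lborel)"

lemma mean_busy_time_eq:
  assumes "j \<in> {1..n}"
  shows "mean_busy_time q I j = busy_moment j / q j"
proof -
  have "(LBINT t:{0..}. I j t * t) = busy_moment j"
    unfolding busy_moment_def set_lebesgue_integral_def
    by (intro Bochner_Integration.integral_cong) (use assms in \<open>auto simp: run_def indicator_def\<close>)
  then show ?thesis by (simp add: mean_busy_time_def)
qed

lemma integrable_run_work: "j \<in> {1..n} \<Longrightarrow> i \<in> {1..n} \<Longrightarrow> integrable lborel (\<lambda>t. run j t * work i t)"
  using work_le[of i] work_nonneg[of i] by (intro integrable_run_mult[where B = "q i"]) auto

text \<open>While \<open>j\<close> runs, the clock shows the idle time frozen at the release of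
  \<open>j\<close> plus the work done on the prefix. This turns first moments of the schedule into
  integrals of \<open>run\<close> against \<open>work\<close>.\<close>

lemma run_time_eq:
  assumes "j \<in> {1..k}" "k \<le> n"
  shows "run j t * t = idle k (r j) * run j t + (\<Sum>i=1..k. run j t * work i t)"
proof (cases "run j t = 0")
  case False
  have "t = idle k (r j) + (\<Sum>i=1..k. work i t)"
    using idle_run[OF assms False] unfolding idle_def by linarith
  then have "run j t * t = run j t * (idle k (r j) + (\<Sum>i=1..k. work i t))" by simp
  then show ?thesis by (simp add: distrib_left sum_distrib_left)
qed simp

lemma busy_moment_eq:
  assumes "j \<in> {1..k}" "k \<le> n"
  shows "busy_moment j = idle k (r j) * q j + (\<Sum>i=1..k. \<integral>t. run j t * work i t \<partial>lborel)"
proof -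
  have j: "j \<in> {1..n}" using assms by auto
  have int: "integrable lborel (\<lambda>t. run j t * work i t)" if "i \<in> {1..k}" for i
    using that assms j by (intro integrable_run_work) auto
  show ?thesis
    unfolding busy_moment_def run_time_eq[OF assms] using int integral_run[OF j]
    by (subst Bochner_Integration.integral_add)
       (auto intro!: Bochner_Integration.integrable_sum Bochner_Integration.integral_sum)
qed

text \<open>Summed over a prefix, the integrals of \<open>run j\<close> against
  \<open>work i\<close> become the integral of the total rate \<open>Y\<close> against its own
  primitive, which \<open>integral_times_work\<close> evaluates. The order of service inside the
  prefix has disappeared; only the idle times at the releases remain.\<close>

lemma busy_moment_prefix_sum:
  assumes k: "k \<le> n"
  shows "(\<Sum>j=1..k. busy_moment j) = (\<Sum>j=1..k. idle k (r j) * q j) + (\<Sum>j=1..k. q j)\<^sup>2 / 2"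
proof -
  define Y where "Y t = (\<Sum>j=1..k. run j t)" for t
  have Y: "Y \<in> borel_measurable borel" "\<And>t. 0 \<le> Y t" "\<And>t. Y t \<le> 1"
    unfolding Y_def using sum_run_le_1[of "{1..k}"] k by (auto intro!: sum_nonneg run_nonneg)
  have W: "(LBINT s:{0..t}. Y s) = (\<Sum>i=1..k. work i t)" for t
    using integrable_run_Icc[of 0 t]
    unfolding Y_def work_def set_lebesgue_integral_def set_integrable_def scaleR_right.sum
    by (intro Bochner_Integration.integral_sum)
  have "(\<Sum>j=1..k. busy_moment j) = (\<Sum>j=1..k. idle k (r j) * q j) +
      (\<Sum>j=1..k. \<Sum>i=1..k. \<integral>t. run j t * work i t \<partial>lborel)"
    unfolding sum.distrib[symmetric] using k by (intro sum.cong refl busy_moment_eq) auto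
  also have "(\<Sum>j=1..k. \<Sum>i=1..k. \<integral>t. run j t * work i t \<partial>lborel) =
      (\<integral>t. Y t * (LBINT s:{0..t}. Y s) \<partial>lborel)"
    unfolding W unfolding Y_def sum_product using k
    by (subst Bochner_Integration.integral_sum Bochner_Integration.integrable_sum,
        auto intro!: integrable_run_work Bochner_Integration.integral_sum[symmetric]
          Bochner_Integration.integrable_sum sum.cong)
  also have "\<dots> = (\<integral>t. Y t \<partial>lborel)\<^sup>2 / 2"
    by (rule integral_times_work[OF Y, of horizon]) (simp add: Y_def run_outside)
  also have "(\<integral>t. Y t \<partial>lborel) = (\<Sum>j=1..k. q j)"
    unfolding Y_def using k by (simp add: integral_run)
  finally show ?thesis .
qed

lemma higher_priority_when_running:
  assumes "j \<in> {1..n}" "k \<in> {1..<j}" "run j t \<noteq> 0"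
  shows "work k t = (if r k \<le> t then q k else 0)"
proof -
  have "0 \<le> t" using assms(3) run_outside[of t j] by force
  then have "\<not> pend k t" using run_eq[OF assms(1)] assms by (auto split: if_splits)
  then show ?thesis
    using work_le[of k t] work_before_release[of t k] assms by (auto simp: pend_def)
qed

text \<open>The work on \<open>j\<close> itself contributes half a square. A job
  \<open>k < j\<close> has received either nothing or all of \<open>q k\<close> whenever
  \<open>j\<close> runs, so it contributes \<open>q k\<close> for exactly that part of
  \<open>j\<close> that is processed after \<open>r k\<close>.\<close>

lemma busy_moment_job:
  assumes j: "j \<in> {1..n}"
  shows "busy_moment j = idle j (r j) * q j + (q j)\<^sup>2 / 2 + (\<Sum>k=1..<j. q k * (q j - work j (r k)))"
proof -
  have "(\<integral>t. run j t * work k t \<partial>lborel) = q k * (q j - work j (r k))" if k: "k \<in> {1..<j}" for k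
  proof -
    have "AE t in lborel. t \<noteq> r k" by (rule AE_lborel_singleton)
    moreover have "run j t * work k t = q k * (indicator {r k<..} t * run j t)" if "t \<noteq> r k" for t
      using higher_priority_when_running[OF j k, of t] that
      by (cases "run j t = 0") (auto simp: indicator_def)
    ultimately have "(\<integral>t. run j t * work k t \<partial>lborel) = (\<integral>t. q k * (indicator {r k<..} t * run j t) \<partial>lborel)"
      by (intro integral_cong_AE) (auto elim!: eventually_mono)
    then show ?thesis using integral_run_after[OF j, of "r k"] release_nonneg[of k] k j by simp
  qed
  moreover have "(\<integral>t. run j t * work j t \<partial>lborel) = (q j)\<^sup>2 / 2"
    unfolding work_def integral_run[OF j, symmetric]
    by (rule integral_times_work[OF run_measurable run_nonneg run_le_1 run_outside])
  moreover have "{1..j} = insert j {1..<j}" using j by auto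
  ultimately show ?thesis using busy_moment_eq[of j j] j by simp
qed

end

section \<open>The FIFO queue and the \<open>\<alpha>\<close>-points\<close>

text \<open>The free time \<open>b\<close> is arbitrary so that the induction along the queue goes
  through. Either the machine works without a pause from \<open>b\<close> until \<open>j\<close>
  starts, or its last wait ends with the entry of some job; the two cases are the two arguments of
  \<open>max\<close>.\<close>

lemma fifo_bound_aux:
  assumes "sorted (map e ks)" "distinct ks" "j \<in> set ks"
    and "\<And>s A. A \<subseteq> set ks - {j} \<Longrightarrow> (\<And>l. l \<in> A \<Longrightarrow> s \<le> e l \<and> e l \<le> e j) \<Longrightarrow>
           0 \<le> s \<Longrightarrow> s \<le> e j \<Longrightarrow> s + (\<Sum>l\<in>A. y l) \<le> e j"
    and "\<And>k. k \<in> set ks \<Longrightarrow> 0 \<le> e k"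
  shows "\<exists>A \<subseteq> {k\<in>set ks - {j}. e k \<le> e j}. fifo e x ks b j \<le>
           x j + max (b + (\<Sum>k\<in>A. x k)) (e j + (\<Sum>k\<in>A. max 0 (x k - y k)))"
  using assms
proof (induction ks arbitrary: b)
  case Nil
  then show ?case by simp
next
  case (Cons k ks)
  show ?case
  proof (cases "k = j")
    case True
    then show ?thesis by (intro exI[of _ "{}"]) (simp add: Let_def)
  next
    case False
    define C where "C = max b (e k) + x k"
    have "\<exists>A\<subseteq>{k\<in>set ks - {j}. e k \<le> e j}. fifo e x ks C j \<le>
           x j + max (C + (\<Sum>k\<in>A. x k)) (e j + (\<Sum>k\<in>A. max 0 (x k - y k)))"
      using Cons.prems False by (intro Cons.IH) auto
    then obtain A where A: "A \<subseteq> {k\<in>set ks - {j}. e k \<le> e j}" "fifo e x ks C j \<le>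
           x j + max (C + (\<Sum>k\<in>A. x k)) (e j + (\<Sum>k\<in>A. max 0 (x k - y k)))"
      by blast
    have finA: "finite A" using A(1) finite_subset by fastforce
    have kA: "k \<notin> A" using A Cons.prems(2) by auto
    have kj: "e k \<le> e j" using Cons.prems False by auto
    \<comment> \<open>This covers the case that the machine waits for \<open>k\<close>: the queue is
      sorted, so all jobs counted enter at \<open>e k\<close> or later, and their charges fit
      between \<open>e k\<close> and \<open>e j\<close>.\<close>
    have "e k + (\<Sum>l\<in>insert k A. y l) \<le> e j"
      using A(1) Cons.prems(1,5) kj False by (intro Cons.prems(4)) auto
    moreover have "(\<Sum>l\<in>insert k A. x l) - (\<Sum>l\<in>insert k A. y l) \<le>
        (\<Sum>l\<in>insert k A. max 0 (x l - y l))"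
      unfolding sum_subtractf[symmetric] by (intro sum_mono) auto
    moreover have "(\<Sum>l\<in>A. max 0 (x l - y l)) \<le> (\<Sum>l\<in>insert k A. max 0 (x l - y l))"
      using finA kA by simp
    moreover have "(\<Sum>l\<in>insert k A. x l) = x k + (\<Sum>l\<in>A. x l)"
      using finA kA by simp
    ultimately have "max (C + (\<Sum>k\<in>A. x k)) (e j + (\<Sum>k\<in>A. max 0 (x k - y k))) \<le>
        max (b + (\<Sum>l\<in>insert k A. x l)) (e j + (\<Sum>l\<in>insert k A. max 0 (x l - y l)))"
      unfolding C_def by linarith
    moreover have "fifo e x (k # ks) b j = fifo e x ks C j"
      using False by (simp add: Let_def C_def)
    ultimately have "fifo e x (k # ks) b j \<le>
        x j + max (b + (\<Sum>l\<in>insert k A. x l)) (e j + (\<Sum>l\<in>insert k A. max 0 (x l - y l)))"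
      using A(2) by linarith
    moreover have "insert k A \<subseteq> {l \<in> set (k # ks) - {j}. e l \<le> e j}"
      using A(1) kj False by auto
    ultimately show ?thesis by blast
  qed
qed

text \<open>Here \<open>y l\<close> bounds from below the share of the time between the entries of \<open>l\<close> and \<open>j\<close> that can
  be charged to \<open>l\<close>; only the excess of \<open>x l\<close> over \<open>y l\<close> can delay \<open>j\<close>.\<close>

lemma fifo_bound:
  assumes "sorted (map e ks)" "distinct ks" "j \<in> set ks"
    and charge: "\<And>s A. A \<subseteq> set ks - {j} \<Longrightarrow> (\<And>l. l \<in> A \<Longrightarrow> s \<le> e l \<and> e l \<le> e j) \<Longrightarrow>
           0 \<le> s \<Longrightarrow> s \<le> e j \<Longrightarrow> s + (\<Sum>l\<in>A. y l) \<le> e j"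
    and nonneg: "\<And>k. k \<in> set ks \<Longrightarrow> 0 \<le> e k"
  shows "fifo e x ks 0 j \<le> x j + e j + (\<Sum>k\<in>{k\<in>set ks - {j}. e k \<le> e j}. max 0 (x k - y k))"
proof -
  obtain A where A: "A \<subseteq> {k\<in>set ks - {j}. e k \<le> e j}" "fifo e x ks 0 j \<le>
           x j + max (0 + (\<Sum>k\<in>A. x k)) (e j + (\<Sum>k\<in>A. max 0 (x k - y k)))"
    using fifo_bound_aux[OF assms, of x 0] by blast
  \<comment> \<open>With free time 0, charging from \<open>s = 0\<close> bounds the first argument
    of \<open>max\<close> by the entry time plus the excesses as well.\<close>
  have "0 + (\<Sum>l\<in>A. y l) \<le> e j"
    using A(1) nonneg assms(3) by (intro charge) auto
  moreover have "(\<Sum>l\<in>A. x l) - (\<Sum>l\<in>A. y l) \<le> (\<Sum>l\<in>A. max 0 (x l - y l))"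
    unfolding sum_subtractf[symmetric] by (intro sum_mono) auto
  moreover have "(\<Sum>l\<in>A. max 0 (x l - y l)) \<le> (\<Sum>k\<in>{k\<in>set ks - {j}. e k \<le> e j}. max 0 (x k - y k))"
    using A(1) by (intro sum_mono2) auto
  ultimately show ?thesis using A(2) by linarith
qed

section \<open>The \<alpha>-points of the preemptive schedule\<close>

context wspt_schedule begin

text \<open>The times at which enough work is done form a closed set that contains
  \<open>horizon\<close>, so \<open>LEAST\<close> is a genuine minimum; by continuity the required
  amount is met there with equality.\<close>

lemma alpha_point_props:
  assumes j: "j \<in> {1..n}" and a: "0 < a" "a \<le> 1"
  shows alpha_point_nonneg: "0 \<le> alpha_point q I j a"
    and work_alpha_point: "work j (alpha_point q I j a) = a * q j"
    and alpha_point_le_iff: "0 \<le> t \<Longrightarrow> alpha_point q I j a \<le> t \<longleftrightarrow> a * q j \<le> work j t"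
proof -
  let ?K = "{0..horizon} \<inter> work j -` {a * q j..}"
  have "closed (work j -` {a * q j..})"
    using work_continuous_on[of UNIV j] by (simp add: closed_vimage continuous_on_closed_vimage)
  then have "compact ?K" by (rule compact_Int_closed[OF compact_Icc])
  moreover have "horizon \<in> ?K"
    using horizon_pos work_horizon[OF j, of horizon] q_pos[OF j] a by simp
  ultimately obtain T where T: "T \<in> ?K" "\<And>s. s \<in> ?K \<Longrightarrow> T \<le> s"
    using compact_attains_inf[of ?K] by blast
  have least: "T \<le> t" if "0 \<le> t" "a * q j \<le> work j t" for t
    using T(1) T(2)[of t] that by (cases "t \<le> horizon") auto
  have eq: "alpha_point q I j a = T"
    unfolding alpha_point_def work_eq[OF j, symmetric]
    using T(1) least by (intro Least_equality) auto
  show "0 \<le> alpha_point q I j a" using T eq by simp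
  show "alpha_point q I j a \<le> t \<longleftrightarrow> a * q j \<le> work j t" if "0 \<le> t"
    using least[OF that] T(1) work_mono_time[of T t j] unfolding eq by auto
  have "work j 0 \<le> a * q j" using work_0[of 0 j] a q_pos[OF j] by simp
  moreover have "a * q j \<le> work j T" "0 \<le> T" using T(1) by auto
  ultimately obtain s where s: "0 \<le> s" "s \<le> T" "work j s = a * q j"
    using IVT'[of "work j" 0 "a * q j" T] work_continuous_on by auto
  then have "s = T" using least[of s] by simp
  then show "work j (alpha_point q I j a) = a * q j" using s eq by simp
qed

lemma work_before_alpha_point:
  assumes "j \<in> {1..n}" "0 < a" "a \<le> 1" "t < alpha_point q I j a"
  shows "work j t < a * q j"
proof (cases "0 \<le> t")
  case True
  then show ?thesis using alpha_point_le_iff[OF assms(1-3) True] assms(4) by linarith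
next
  case False
  then show ?thesis using work_0[of t j] q_pos[OF assms(1)] assms(2) by simp
qed

lemma alpha_point_ge_release:
  assumes "j \<in> {1..n}" "0 < a" "a \<le> 1"
  shows "r j \<le> alpha_point q I j a"
proof (rule ccontr)
  assume "\<not> ?thesis"
  then have "work j (alpha_point q I j a) = 0" by (intro work_before_release) simp
  then show False using work_alpha_point[OF assms] q_pos[OF assms(1)] assms(2) by simp
qed

text \<open>Until its \<alpha>-point job \<open>j\<close> is pending, hence the idle time of
  \<open>{1..j}\<close> is still the one at \<open>r j\<close>. That term does not depend on
  \<open>a\<close>.\<close>

lemma alpha_point_eq:
  assumes j: "j \<in> {1..n}" and a: "0 < a" "a \<le> 1"
  shows "alpha_point q I j a =
    idle j (r j) + a * q j + (\<Sum>k=1..<j. work k (alpha_point q I j a))"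
proof -
  have "a * q j \<le> q j" using a q_pos[OF j] by simp
  then have "idle j (alpha_point q I j a) = idle j (r j)"
    using j alpha_point_ge_release[OF j a] work_before_alpha_point[OF j a]
    by (intro idle_pend) (force simp: pend_def)+
  moreover have "{1..j} = insert j {1..<j}" using j by auto
  ultimately show ?thesis using work_alpha_point[OF j a] by (simp add: idle_def)
qed

text \<open>Jobs of larger index can only use time that \<open>{1..j}\<close> leaves free, and none
  of that is added between the release of \<open>j\<close> and its \<alpha>-point.\<close>

lemma lower_priority_work_le:
  assumes j: "j \<in> {1..n}" and a: "0 < a" "a \<le> 1"
  shows "(\<Sum>k=Suc j..n. work k (alpha_point q I j a)) \<le> idle j (r j)"
proof -
  let ?C = "alpha_point q I j a"
  have "{1..n} = insert j ({1..<j} \<union> {Suc j..n})" using j by auto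
  moreover have "(\<Sum>k\<in>{1..<j} \<union> {Suc j..n}. work k ?C) =
      (\<Sum>k=1..<j. work k ?C) + (\<Sum>k=Suc j..n. work k ?C)"
    by (rule sum.union_disjoint) auto
  ultimately have "(\<Sum>k=1..n. work k ?C) =
      work j ?C + ((\<Sum>k=1..<j. work k ?C) + (\<Sum>k=Suc j..n. work k ?C))"
    by simp
  then show ?thesis
    using sum_work_le[of "{1..n}" ?C] alpha_point_eq[OF j a] work_alpha_point[OF j a]
      alpha_point_nonneg[OF j a] by simp
qed

text \<open>Job \<open>j\<close> must receive work immediately before its \<alpha>-point, by
  minimality. If \<open>k\<close> were partly done there, continuity would make it started and
  unfinished on an interval just before, and it would block \<open>j\<close> on that interval. If
  \<open>k\<close> is done, its release precedes the \<alpha>-point, which gives the second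
  inequality.\<close>

lemma higher_priority_work_cases:
  assumes j: "j \<in> {1..n}" and k: "k \<in> {1..<j}" and a: "0 < a" "a \<le> 1"
  shows "work k (alpha_point q I j a) = 0 \<or>
         work k (alpha_point q I j a) = q k \<and> work j (r k) < a * q j"
proof (rule disj_imp[THEN iffD2], rule impI)
  let ?C = "alpha_point q I j a"
  have kn: "k \<in> {1..n}" using j k by auto
  assume "work k ?C \<noteq> 0"
  then have pos: "0 < work k ?C" using work_nonneg[of k ?C] by linarith
  have rel: "r k < t" if "0 < work k t" for t
    using work_before_release[of t k] that by (cases "r k < t") auto
  have "work k ?C = q k"
  proof (rule ccontr)
    assume "work k ?C \<noteq> q k"
    then have lt: "work k ?C < q k" using work_le[OF kn, of ?C] by linarith
    have C0: "0 < ?C" using rel[OF pos] release_nonneg[OF kn] by linarith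
    have "isCont (work k) ?C"
      using work_continuous_on[of UNIV k] by (simp add: continuous_on_eq_continuous_at)
    then have "eventually (\<lambda>t. 0 < work k t) (at ?C)"
      using pos unfolding isCont_def by (rule order_tendstoD(1))
    then obtain d where d: "d > 0" "\<And>t. t \<noteq> ?C \<Longrightarrow> dist t ?C < d \<Longrightarrow> 0 < work k t"
      unfolding eventually_at by blast
    \<comment> \<open>A point strictly before the \<alpha>-point inside the neighbourhood, cut off
      at 0 because \<open>run_eq\<close> speaks of nonnegative times only.\<close>
    define s where "s = max 0 (?C - d / 2)"
    have s: "0 \<le> s" "s < ?C" "dist s ?C < d"
      using C0 d(1) by (auto simp: s_def dist_real_def)
    have "work j ?C = work j s"
    proof (rule work_const)
      fix u assume u: "s < u" "u < ?C"
      then have "0 < work k u" using d(2)[of u] s by (auto simp: dist_real_def)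
      then have "pend k u" using rel[of u] lt work_mono_time[of u ?C k] u by (auto simp: pend_def)
      then show "run j u = 0" using run_eq[OF j, of u] s u k by auto
    qed (use s in simp)
    then show False
      using work_before_alpha_point[OF j a s(2)] work_alpha_point[OF j a] by simp
  qed
  then show "work k ?C = q k \<and> work j (r k) < a * q j"
    using work_before_alpha_point[OF j a rel[OF pos]] by simp
qed

text \<open>The charge of \<open>k\<close> in \<open>fifo_bound\<close> is the work the preemptive
  schedule does on \<open>k\<close> after the entry of \<open>k\<close> and before that of
  \<open>j\<close>. The charges fit because a machine of unit speed does at most
  \<open>C - s\<close> work between \<open>s\<close> and \<open>C\<close>.\<close>

lemma rsos_completion_le:
  assumes j: "j \<in> {1..n}" and a: "\<And>k. k \<in> {1..n} \<Longrightarrow> 0 < a k \<and> a k \<le> 1"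
  defines "C \<equiv> alpha_point q I j (a j)"
  shows "rsos_completion n q I a x j \<le> x j + C +
    (\<Sum>k\<in>{1..n} - {j}. if a k * q k \<le> work k C then max 0 (x k - (work k C - a k * q k)) else 0)"
proof -
  define e where "e = (\<lambda>k. alpha_point q I k (a k))"
  have C: "C = e j" by (simp add: C_def e_def)
  have C0: "0 \<le> C" unfolding C_def using alpha_point_nonneg[OF j] a[OF j] by blast
  have e_le: "e k \<le> C \<longleftrightarrow> a k * q k \<le> work k C" if "k \<in> {1..n}" for k
    unfolding e_def using alpha_point_le_iff[OF that _ _ C0] a[OF that] by blast
  have "fifo e x (sort_key e [1..<Suc n]) 0 j \<le> x j + e j +
      (\<Sum>k\<in>{k\<in>set (sort_key e [1..<Suc n]) - {j}. e k \<le> e j}. max 0 (x k - (work k C - a k * q k)))"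
  proof (rule fifo_bound)
    fix s A assume A: "A \<subseteq> set (sort_key e [1..<Suc n]) - {j}" "0 \<le> s" "s \<le> e j"
      and between: "\<And>l. l \<in> A \<Longrightarrow> s \<le> e l \<and> e l \<le> e j"
    have sub: "A \<subseteq> {1..n}" using A(1) by auto
    have "work l s \<le> a l * q l" if l: "l \<in> A" for l
      using work_mono_time[of s "e l" l] between[OF l] work_alpha_point[of l "a l"] a[of l] sub l
      by (auto simp: e_def)
    then have "(\<Sum>l\<in>A. work l C - a l * q l) \<le> (\<Sum>l\<in>A. work l C) - (\<Sum>l\<in>A. work l s)"
      unfolding sum_subtractf[symmetric] by (intro sum_mono) auto
    also have "\<dots> \<le> C - s" using sub A C by (intro sum_work_increment_le) auto
    finally show "s + (\<Sum>l\<in>A. work l C - a l * q l) \<le> e j" using C by simp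
  next
    fix k assume "k \<in> set (sort_key e [1..<Suc n])"
    then show "0 \<le> e k" unfolding e_def using alpha_point_nonneg[of k "a k"] a[of k] by auto
  qed (use j in auto)
  also have "{k\<in>set (sort_key e [1..<Suc n]) - {j}. e k \<le> e j} =
      {k\<in>{1..n} - {j}. a k * q k \<le> work k C}"
    using e_le C by auto
  also have "(\<Sum>k\<in>{k\<in>{1..n} - {j}. a k * q k \<le> work k C}. max 0 (x k - (work k C - a k * q k))) =
    (\<Sum>k\<in>{1..n} - {j}. if a k * q k \<le> work k C then max 0 (x k - (work k C - a k * q k)) else 0)"
    by (rule sum.inter_filter) simp
  finally show ?thesis unfolding rsos_completion_def e_def Let_def C_def by simp
qed

text \<open>Outside \<open>(0,1]\<close> the \<open>\<alpha>\<close>-point is junk; this variant is monotone on the whole line, hence Borel.\<close>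

definition entry :: "nat \<Rightarrow> real \<Rightarrow> real" where
  "entry j a = (if a \<le> 0 then 0 else alpha_point q I j (min a 1))"

lemma entry_eq: "0 < a \<Longrightarrow> a \<le> 1 \<Longrightarrow> entry j a = alpha_point q I j a"
  by (simp add: entry_def)

lemma entry_measurable [measurable]:
  assumes j: "j \<in> {1..n}"
  shows "entry j \<in> borel_measurable borel"
proof (rule borel_measurable_mono, rule monoI)
  fix a b :: real assume ab: "a \<le> b"
  show "entry j a \<le> entry j b"
  proof (cases "a \<le> 0")
    case True
    then show ?thesis using alpha_point_nonneg[OF j, of "min b 1"] by (auto simp: entry_def)
  next
    case False
    have "min a 1 * q j \<le> min b 1 * q j" using ab q_pos[OF j] by (intro mult_right_mono) auto
    also have "\<dots> = work j (alpha_point q I j (min b 1))"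
      using work_alpha_point[OF j, of "min b 1"] False ab by simp
    finally have "alpha_point q I j (min a 1) \<le> alpha_point q I j (min b 1)"
      using alpha_point_le_iff[OF j, of "min a 1"] alpha_point_nonneg[OF j, of "min b 1"] False ab
      by simp
    then show ?thesis using False ab by (simp add: entry_def)
  qed
qed

end

section \<open>Excess of a random processing time\<close>

lemma gfun_bounds:
  assumes "0 \<le> \<Delta>"
  shows "0 \<le> gfun \<Delta>" "gfun \<Delta> \<le> 1"
proof -
  have "0 \<le> sqrt \<Delta>" using assms by simp
  moreover have "sqrt \<Delta> \<le> 2" if "\<Delta> \<le> 1"
    by (rule real_le_lsqrt) (use that assms in auto)
  ultimately show "0 \<le> gfun \<Delta>" "gfun \<Delta> \<le> 1" using assms by (auto simp: gfun_def)
qed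

context prob_space begin

text \<open>The variance of the absolute deviation is nonnegative.\<close>

lemma expectation_abs_deviation_le:
  fixes X :: "'a \<Rightarrow> real"
  assumes [simp]: "integrable M X" "integrable M (\<lambda>\<omega>. (X \<omega>)\<^sup>2)"
  shows "expectation (\<lambda>\<omega>. \<bar>X \<omega> - m\<bar>) \<le> sqrt (expectation (\<lambda>\<omega>. (X \<omega> - m)\<^sup>2))"
proof -
  have "integrable M (\<lambda>\<omega>. (X \<omega> - m)\<^sup>2)" by (simp add: power2_diff)
  then have "variance (\<lambda>\<omega>. \<bar>X \<omega> - m\<bar>) =
      expectation (\<lambda>\<omega>. \<bar>X \<omega> - m\<bar>\<^sup>2) - (expectation (\<lambda>\<omega>. \<bar>X \<omega> - m\<bar>))\<^sup>2"
    by (intro variance_eq) auto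
  moreover have "0 \<le> variance (\<lambda>\<omega>. \<bar>X \<omega> - m\<bar>)" by (rule variance_positive)
  ultimately have "(expectation (\<lambda>\<omega>. \<bar>X \<omega> - m\<bar>))\<^sup>2 \<le> expectation (\<lambda>\<omega>. (X \<omega> - m)\<^sup>2)" by simp
  then show ?thesis by (rule real_le_rsqrt)
qed

text \<open>The function \<open>g\<close> is chosen so that this holds: for \<open>\<Delta> \<le> 1\<close> the bound interpolates between
  \<open>y = 0\<close> and \<open>y = 1\<close>, for \<open>\<Delta> > 1\<close> it is attained by a two-point distribution on \<open>{0, (1 + \<Delta>) m}\<close>
  and certified by the quadratic majorant touching at these points.\<close>

lemma expectation_excess_le:
  fixes X :: "'a \<Rightarrow> real"
  assumes nonneg: "AE \<omega> in M. 0 \<le> X \<omega>"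
    and X [simp]: "integrable M X" and X2 [simp]: "integrable M (\<lambda>\<omega>. (X \<omega>)\<^sup>2)"
    and m: "m = expectation X" "0 < m" and cv: "cv_squared M X \<le> \<Delta>"
    and y: "0 \<le> y" "y \<le> 1"
  shows "expectation (\<lambda>\<omega>. max 0 (X \<omega> - y * m)) \<le> m * (1 - gfun \<Delta> * y)"
proof -
  have var: "variance X \<le> \<Delta> * m\<^sup>2"
    using cv m by (simp add: cv_squared_def divide_le_eq)
  have var_eq: "variance X = expectation (\<lambda>\<omega>. (X \<omega>)\<^sup>2) - m\<^sup>2"
    using m by (simp add: variance_eq)
  have int: "integrable M (\<lambda>\<omega>. max 0 (X \<omega> - y * m))" by simp
  show ?thesis
  proof (cases "\<Delta> \<le> 1")
    case True
    have "expectation (\<lambda>\<omega>. max 0 (X \<omega> - y * m)) \<le>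
        expectation (\<lambda>\<omega>. (1 - y) * X \<omega> + y * ((\<bar>X \<omega> - m\<bar> + (X \<omega> - m)) / 2))"
    proof (rule integral_mono_AE)
      show "AE \<omega> in M. max 0 (X \<omega> - y * m) \<le> (1 - y) * X \<omega> + y * ((\<bar>X \<omega> - m\<bar> + (X \<omega> - m)) / 2)"
        using nonneg
      proof eventually_elim
        case (elim \<omega>)
        define P where "P = (\<bar>X \<omega> - m\<bar> + (X \<omega> - m)) / 2"
        have P: "0 \<le> P" "X \<omega> - m \<le> P" by (auto simp: P_def)
        have "y * (X \<omega> - m) \<le> y * P" "0 \<le> y * P" using y P by (auto intro!: mult_left_mono)
        moreover have "0 \<le> (1 - y) * X \<omega>" using elim y by simp
        ultimately show ?case unfolding P_def[symmetric] by (simp add: algebra_simps)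
      qed
    qed (use int in auto)
    \<comment> \<open>The signed deviation has mean zero, so half of the mean absolute deviation is
      left.\<close>
    also have "\<dots> = (1 - y) * m + y * (expectation (\<lambda>\<omega>. \<bar>X \<omega> - m\<bar>) / 2)"
      using m by (simp add: prob_space)
    also have "expectation (\<lambda>\<omega>. \<bar>X \<omega> - m\<bar>) \<le> sqrt \<Delta> * m"
    proof -
      have "expectation (\<lambda>\<omega>. \<bar>X \<omega> - m\<bar>) \<le> sqrt (variance X)"
        using expectation_abs_deviation_le[OF X X2, of m] m by simp
      also have "\<dots> \<le> sqrt (\<Delta> * m\<^sup>2)" using var by simp
      also have "\<dots> = sqrt \<Delta> * m" using m by (simp add: real_sqrt_mult)
      finally show ?thesis .
    qed
    also have "(1 - y) * m + y * (sqrt \<Delta> * m / 2) = m * (1 - gfun \<Delta> * y)"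
      using True by (simp add: gfun_def algebra_simps diff_divide_distrib)
    finally show ?thesis using y by (simp add: mult_left_mono)
  next
    case False
    \<comment> \<open>The upper atom of the extremal distribution. That \<open>b\<close> is at least
      \<open>2 * m\<close> keeps the quadratic majorant above 0; completing the square at
      \<open>b\<close> keeps it above the line \<open>X \<omega> - y * m\<close>.\<close>
    define b where "b = (1 + \<Delta>) * m"
    have b: "2 * m \<le> b" "0 < b" using False m by (auto simp: b_def)
    have "expectation (\<lambda>\<omega>. max 0 (X \<omega> - y * m)) \<le>
        expectation (\<lambda>\<omega>. X \<omega> + y * m * ((X \<omega>)\<^sup>2 / b\<^sup>2 - 2 * X \<omega> / b))"
    proof (rule integral_mono_AE)
      show "AE \<omega> in M. max 0 (X \<omega> - y * m) \<le> X \<omega> + y * m * ((X \<omega>)\<^sup>2 / b\<^sup>2 - 2 * X \<omega> / b)"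
        using nonneg
      proof eventually_elim
        case (elim \<omega>)
        have "y * (2 * m) \<le> 1 * b" using y b m by (intro mult_mono) auto
        then have "y * m * (2 * X \<omega> / b) \<le> X \<omega>"
          using elim b mult_right_mono[of "y * (2 * m)" b "X \<omega>"] by (simp add: field_simps)
        moreover have "0 \<le> y * m * ((X \<omega>)\<^sup>2 / b\<^sup>2)" using y m by simp
        ultimately have "0 \<le> X \<omega> + y * m * ((X \<omega>)\<^sup>2 / b\<^sup>2 - 2 * X \<omega> / b)"
          by (simp add: algebra_simps)
        moreover have "0 \<le> y * m * (X \<omega> / b - 1)\<^sup>2" using y m by simp
        then have "X \<omega> - y * m \<le> X \<omega> + y * m * ((X \<omega>)\<^sup>2 / b\<^sup>2 - 2 * X \<omega> / b)"
          by (simp add: power2_diff power_divide algebra_simps)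
        ultimately show ?case by simp
      qed
    qed (use int in auto)
    also have "\<dots> = m + y * m * (expectation (\<lambda>\<omega>. (X \<omega>)\<^sup>2) / b\<^sup>2 - 2 * m / b)"
      using m by simp
    also have "expectation (\<lambda>\<omega>. (X \<omega>)\<^sup>2) \<le> b * m"
      using var var_eq by (simp add: b_def power2_eq_square algebra_simps)
    also have "m + y * m * (b * m / b\<^sup>2 - 2 * m / b) = m * (1 - gfun \<Delta> * y)"
    proof -
      have "b * m / b\<^sup>2 = m / b" using b by (simp add: power2_eq_square)
      moreover have "2 * m / b = 2 * gfun \<Delta>" "m / b = gfun \<Delta>"
        using m False by (simp_all add: b_def gfun_def add.commute)
      ultimately show ?thesis by (simp only:) (simp add: algebra_simps)
    qed
    finally show ?thesis using y m by (simp add: mult_left_mono divide_right_mono)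
  qed
qed

section \<open>Iterated integrals for independent random variables\<close>

lemma indep_var_nn_integral:
  assumes ind: "indep_var N1 X N2 Y"
    and h [measurable]: "h \<in> borel_measurable (N1 \<Otimes>\<^sub>M N2)"
  shows "(\<integral>\<^sup>+\<omega>. h (X \<omega>, Y \<omega>) \<partial>M) = (\<integral>\<^sup>+\<omega>. \<integral>\<^sup>+\<omega>'. h (X \<omega>, Y \<omega>') \<partial>M \<partial>M)"
proof -
  have [measurable]: "X \<in> measurable M N1" "Y \<in> measurable M N2"
    using indep_var_rv1[OF ind] indep_var_rv2[OF ind] by auto
  interpret Y: prob_space "distr M N2 Y" by (rule prob_space_distr) simp
  have "(\<integral>\<^sup>+\<omega>. h (X \<omega>, Y \<omega>) \<partial>M) = (\<integral>\<^sup>+z. h z \<partial>distr M (N1 \<Otimes>\<^sub>M N2) (\<lambda>\<omega>. (X \<omega>, Y \<omega>)))"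
    by (simp add: nn_integral_distr)
  also have "\<dots> = (\<integral>\<^sup>+z. h z \<partial>(distr M N1 X \<Otimes>\<^sub>M distr M N2 Y))"
    using ind unfolding indep_var_distribution_eq by simp
  also have "\<dots> = (\<integral>\<^sup>+x. \<integral>\<^sup>+y. h (x, y) \<partial>distr M N2 Y \<partial>distr M N1 X)"
    by (intro Y.nn_integral_fst[symmetric]) simp
  also have "\<dots> = (\<integral>\<^sup>+\<omega>. \<integral>\<^sup>+\<omega>'. h (X \<omega>, Y \<omega>') \<partial>M \<partial>M)"
    by (simp add: nn_integral_distr cong: nn_integral_cong)
  finally show ?thesis .
qed

text \<open>First one variable is split from the other two, then these from each other. The intended
  triple consists of the two draws and the processing time that together determine one
  delay.\<close>

lemma indep_vars_nn_integral_triple: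
  assumes ind: "indep_vars (\<lambda>_. borel) Z K" and K: "i \<in> K" "j \<in> K" "k \<in> K"
    and ne: "i \<noteq> j" "i \<noteq> k" "j \<noteq> k"
    and h [measurable]: "h \<in> borel_measurable (borel \<Otimes>\<^sub>M (borel \<Otimes>\<^sub>M borel))"
  shows "(\<integral>\<^sup>+\<omega>. h (Z i \<omega>, Z j \<omega>, Z k \<omega>) \<partial>M) =
    (\<integral>\<^sup>+\<omega>. \<integral>\<^sup>+\<omega>'. \<integral>\<^sup>+\<omega>''. h (Z i \<omega>, Z j \<omega>', Z k \<omega>'') \<partial>M \<partial>M \<partial>M)"
proof -
  have [measurable]: "Z l \<in> borel_measurable M" if "l \<in> K" for l
    using ind that unfolding indep_vars_def by auto
  have 1: "indep_var (Pi\<^sub>M {i} (\<lambda>_. borel)) (\<lambda>\<omega>. restrict (\<lambda>l. Z l \<omega>) {i})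
      (Pi\<^sub>M {j, k} (\<lambda>_. borel)) (\<lambda>\<omega>. restrict (\<lambda>l. Z l \<omega>) {j, k})"
    using K ne by (intro indep_var_restrict[OF ind]) auto
  have 2: "indep_var (Pi\<^sub>M {j} (\<lambda>_. borel)) (\<lambda>\<omega>. restrict (\<lambda>l. Z l \<omega>) {j})
      (Pi\<^sub>M {k} (\<lambda>_. borel)) (\<lambda>\<omega>. restrict (\<lambda>l. Z l \<omega>) {k})"
    using K ne by (intro indep_var_restrict[OF ind]) auto
  have "(\<integral>\<^sup>+\<omega>. h (Z i \<omega>, Z j \<omega>, Z k \<omega>) \<partial>M) =
      (\<integral>\<^sup>+\<omega>. \<integral>\<^sup>+\<omega>'. h (Z i \<omega>, Z j \<omega>', Z k \<omega>') \<partial>M \<partial>M)"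
    using indep_var_nn_integral[OF 1, of "\<lambda>(x, y). h (x i, y j, y k)"] by simp
  moreover have "(\<integral>\<^sup>+\<omega>'. h (x, Z j \<omega>', Z k \<omega>') \<partial>M) =
      (\<integral>\<^sup>+\<omega>'. \<integral>\<^sup>+\<omega>''. h (x, Z j \<omega>', Z k \<omega>'') \<partial>M \<partial>M)" for x
    using indep_var_nn_integral[OF 2, of "\<lambda>(y, z). h (x, y j, z k)"] by simp
  ultimately show ?thesis by simp
qed

end

section \<open>Lower bound for scheduling policies\<close>

text \<open>\<open>ennreal\<close> sends negative numbers to 0, so for summands of unknown sign
  additivity survives only as an inequality.\<close>

lemma ennreal_add_le: "ennreal (a + b) \<le> ennreal a + ennreal b"
proof -
  have "ennreal (a + b) \<le> ennreal (max 0 a + max 0 b)" by (rule ennreal_leI) auto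
  then show ?thesis by (simp add: ennreal_plus)
qed

lemma ennreal_sum_le: "ennreal (\<Sum>i\<in>A. h i) \<le> (\<Sum>i\<in>A. ennreal (h i))"
proof (induction A rule: infinite_finite_induct)
  case (insert i A)
  have "ennreal (\<Sum>i\<in>insert i A. h i) \<le> ennreal (h i) + ennreal (\<Sum>i\<in>A. h i)"
    using insert ennreal_add_le by simp
  also have "\<dots> \<le> (\<Sum>i\<in>insert i A. ennreal (h i))"
    using insert by (simp add: add_left_mono)
  finally show ?case .
qed auto

text \<open>Induction by start time: the job that starts last is removed, and its start becomes the
  deadline for the others.\<close>

lemma sum_disjoint_intervals_le:
  fixes S x :: "'b \<Rightarrow> real"
  assumes "finite A" "\<And>i. i \<in> A \<Longrightarrow> 0 \<le> x i" "\<And>i. i \<in> A \<Longrightarrow> b \<le> S i"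
    and "\<And>i l. i \<in> A \<Longrightarrow> l \<in> A \<Longrightarrow> i \<noteq> l \<Longrightarrow> S i + x i \<le> S l \<or> S l + x l \<le> S i"
    and "\<And>i. i \<in> A \<Longrightarrow> S i + x i \<le> t" and "b \<le> t"
  shows "(\<Sum>i\<in>A. x i) \<le> t - b"
  using assms
proof (induction A arbitrary: t rule: finite_ranking_induct[where f = S])
  case (insert l A)
  show ?case
  proof (cases "l \<in> A")
    case True
    then show ?thesis using insert by (simp add: insert_absorb)
  next
    case False
    have eq: "(\<Sum>i\<in>insert l A. x i) = x l + (\<Sum>i\<in>A. x i)" using insert.hyps(1) False by simp
    show ?thesis
    proof (cases "\<forall>i\<in>A. S i + x i \<le> S l")
      case True
      have "(\<Sum>i\<in>A. x i) \<le> S l - b"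
        using insert.prems True by (intro insert.IH) auto
      then show ?thesis using insert.prems(4)[of l] eq by simp
    next
      \<comment> \<open>Some \<open>i\<close> does not end by the start of \<open>l\<close>, so
        \<open>l\<close> ends before \<open>i\<close> starts although it starts no earlier. This is
        possible only if \<open>l\<close> has length 0.\<close>
      case notall: False
      then obtain i where i: "i \<in> A" "\<not> S i + x i \<le> S l" by blast
      then have "S l + x l \<le> S i" using insert.prems(3)[of i l] False by auto
      then have "x l = 0" using insert.hyps(2)[OF i(1)] insert.prems(1)[of l] by simp
      moreover have "(\<Sum>i\<in>A. x i) \<le> t - b"
        using insert.prems by (intro insert.IH) auto
      ultimately show ?thesis using eq by simp
    qed
  qed
qed simp

text \<open>Jobs with the same \<open>u\<close> form a class with a common bound \<open>b\<close>.
  Those of its class that end before \<open>i\<close> starts fit between \<open>b i\<close> and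
  \<open>S i\<close>. Of any two jobs in a class one precedes the other, so \<open>B\<close> and its
  transpose together cover all pairs, which explains the factor 1/2.\<close>

lemma start_times_lower_bound:
  fixes S x u b :: "'b \<Rightarrow> real"
  assumes fin: "finite A" and x: "\<And>i. i \<in> A \<Longrightarrow> 0 \<le> x i" and bS: "\<And>i. i \<in> A \<Longrightarrow> b i \<le> S i"
    and disj: "\<And>i l. i \<in> A \<Longrightarrow> l \<in> A \<Longrightarrow> i \<noteq> l \<Longrightarrow> S i + x i \<le> S l \<or> S l + x l \<le> S i"
    and ub: "\<And>i l. i \<in> A \<Longrightarrow> l \<in> A \<Longrightarrow> u i = u l \<Longrightarrow> b i = b l"
  shows "(\<Sum>i\<in>A. x i * b i) + (\<Sum>i\<in>A. \<Sum>l\<in>A. if i \<noteq> l \<and> u i = u l then x i * x l else 0) / 2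
    \<le> (\<Sum>i\<in>A. x i * S i)"
proof -
  define E where "E i l = (if i \<noteq> l \<and> u i = u l then x i * x l else 0)" for i l
  define B where "B i l = (if i \<noteq> l \<and> u i = u l \<and> S l + x l \<le> S i then x i * x l else 0)" for i l
  have "(\<Sum>l\<in>A. B i l) \<le> x i * (S i - b i)" if i: "i \<in> A" for i
  proof -
    let ?K = "{l\<in>A. i \<noteq> l \<and> u i = u l \<and> S l + x l \<le> S i}"
    have "(\<Sum>l\<in>A. B i l) = (\<Sum>l\<in>?K. x i * x l)"
      unfolding B_def by (rule sum.inter_filter[OF fin, symmetric])
    also have "\<dots> = x i * (\<Sum>l\<in>?K. x l)" by (simp add: sum_distrib_left)
    also have "(\<Sum>l\<in>?K. x l) \<le> S i - b i"
    proof (rule sum_disjoint_intervals_le[where S = S])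
      show "b i \<le> S l" if "l \<in> ?K" for l
        using that bS[of l] ub[of i l] i by auto
    qed (use fin x disj bS i in auto)
    finally show ?thesis using x[OF i] by (simp add: mult_left_mono)
  qed
  then have "(\<Sum>i\<in>A. \<Sum>l\<in>A. B i l) \<le> (\<Sum>i\<in>A. x i * (S i - b i))" by (rule sum_mono)
  moreover have "(\<Sum>i\<in>A. \<Sum>l\<in>A. E i l) \<le> (\<Sum>i\<in>A. \<Sum>l\<in>A. B i l + B l i)"
    using x disj by (intro sum_mono) (auto simp: E_def B_def mult.commute)
  moreover have "(\<Sum>i\<in>A. \<Sum>l\<in>A. B i l + B l i) = (\<Sum>i\<in>A. \<Sum>l\<in>A. B i l) + (\<Sum>i\<in>A. \<Sum>l\<in>A. B i l)"
    using sum.swap[of "\<lambda>i l. B l i" A A] by (simp add: sum.distrib)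
  ultimately show ?thesis by (simp add: E_def[symmetric] right_diff_distrib sum_subtractf)
qed

text \<open>Abel summation arranged so that nothing is subtracted in \<open>ennreal\<close>: the
  smallest weight is taken off all weights and multiplies the full sum, and the induction handles
  the remaining weights, still nonnegative and nonincreasing.\<close>

lemma ennreal_weighted_sum_le:
  fixes v L :: "nat \<Rightarrow> real" and T :: "nat \<Rightarrow> ennreal"
  assumes "\<And>i. i \<in> {1..n} \<Longrightarrow> 0 \<le> v i"
    and "\<And>i j. i \<in> {1..n} \<Longrightarrow> j \<in> {1..n} \<Longrightarrow> i \<le> j \<Longrightarrow> v j \<le> v i"
    and "\<And>k. k \<le> n \<Longrightarrow> ennreal (\<Sum>i=1..k. L i) \<le> (\<Sum>i=1..k. T i)"
  shows "ennreal (\<Sum>i=1..n. v i * L i) \<le> (\<Sum>i=1..n. ennreal (v i) * T i)"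
  using assms
proof (induction n arbitrary: v)
  case (Suc n)
  define d where "d = v (Suc n)"
  have d: "0 \<le> d" using Suc.prems(1)[of "Suc n"] by (simp add: d_def)
  have vd: "d \<le> v i" if "i \<in> {1..n}" for i
    using Suc.prems(2)[of i "Suc n"] that by (simp add: d_def)
  have "(\<Sum>i=1..Suc n. v i * L i) = (\<Sum>i=1..n. (v i - d) * L i) + d * (\<Sum>i=1..Suc n. L i)"
    by (simp add: d_def sum_distrib_left left_diff_distrib sum_subtractf algebra_simps)
  then have "ennreal (\<Sum>i=1..Suc n. v i * L i) \<le>
      ennreal (\<Sum>i=1..n. (v i - d) * L i) + ennreal (d * (\<Sum>i=1..Suc n. L i))"
    using ennreal_add_le by simp
  also have "ennreal (\<Sum>i=1..n. (v i - d) * L i) \<le> (\<Sum>i=1..n. ennreal (v i - d) * T i)"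
    using Suc.prems vd by (intro Suc.IH) auto
  also have "ennreal (d * (\<Sum>i=1..Suc n. L i)) = ennreal d * ennreal (\<Sum>i=1..Suc n. L i)"
    using d by (rule ennreal_mult')
  also have "ennreal (\<Sum>i=1..Suc n. L i) \<le> (\<Sum>i=1..Suc n. T i)" using Suc.prems(3)[of "Suc n"] by simp
  also have "(\<Sum>i=1..n. ennreal (v i - d) * T i) + ennreal d * (\<Sum>i=1..Suc n. T i) =
      (\<Sum>i=1..n. (ennreal (v i - d) + ennreal d) * T i) + ennreal d * T (Suc n)"
    by (simp add: sum_distrib_left distrib_left distrib_right sum.distrib add_ac)
  also have "(\<Sum>i=1..n. (ennreal (v i - d) + ennreal d) * T i) = (\<Sum>i=1..n. ennreal (v i) * T i)"
    using vd d by (intro sum.cong refl) (simp add: ennreal_plus[symmetric] del: ennreal_plus)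
  finally show ?case by (simp add: d_def add_mono mult_left_mono)
qed simp

text \<open>The history that decides the start of \<open>i\<close> leaves out \<open>i\<close>, so
  it is unchanged when the duration of \<open>i\<close> is replaced by 0. The start time is thereby
  a function of the other durations.\<close>

lemma start_time_independent:
  assumes "nonanticipative n \<sigma>" "x \<in> realisations n" "i \<in> {1..n}"
  shows "\<sigma> (x(i := 0)) i = \<sigma> x i"
proof -
  have "x(i := 0) \<in> realisations n"
    using assms(2,3) by (auto simp: realisations_def PiE_iff extensional_def)
  moreover have "same_history ({1..n} - {i}) (\<sigma> x) x (x(i := 0)) (\<sigma> x i)"
    by (auto simp: same_history_def)
  ultimately show ?thesis using assms unfolding nonanticipative_def by blast
qed

section \<open>Random processing times under an arbitrary policy\<close>

locale stochastic_instance = prob_space M + wspt_schedule n r q I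
  for M :: "'a measure" and n :: nat and r q :: "nat \<Rightarrow> real" and I :: "nat \<Rightarrow> real \<Rightarrow> real" +
  fixes p :: "nat \<Rightarrow> 'a \<Rightarrow> real"
  assumes p_nonneg: "j \<in> {1..n} \<Longrightarrow> AE \<omega> in M. 0 \<le> p j \<omega>"
    and p_integrable: "j \<in> {1..n} \<Longrightarrow> integrable M (p j)"
    and q_eq: "j \<in> {1..n} \<Longrightarrow> q j = expectation (p j)"
    and p_indep: "indep_vars (\<lambda>_. borel) p {1..n}"
begin

lemma p_measurable [measurable]: "j \<in> {1..n} \<Longrightarrow> p j \<in> borel_measurable M"
  using p_integrable by blast

definition realised :: "'a \<Rightarrow> nat \<Rightarrow> real" where
  "realised \<omega> = (\<lambda>i\<in>{1..n}. p i \<omega>)"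

lemma realised_measurable [measurable]: "realised \<in> measurable M (\<Pi>\<^sub>M i\<in>{1..n}. borel)"
  unfolding realised_def by measurable

lemma AE_p_nonneg: "AE \<omega> in M. \<forall>j\<in>{1..n}. 0 \<le> p j \<omega>"
  using p_nonneg by (intro AE_finite_allI) auto

lemma realised_in_realisations: "\<forall>j\<in>{1..n}. 0 \<le> p j \<omega> \<Longrightarrow> realised \<omega> \<in> realisations n"
  by (auto simp: realised_def realisations_def)

lemma nn_integral_p: "j \<in> {1..n} \<Longrightarrow> (\<integral>\<^sup>+\<omega>. ennreal (p j \<omega>) \<partial>M) = ennreal (q j)"
  unfolding q_eq by (rule nn_integral_eq_integral[OF p_integrable p_nonneg])

lemma expectation_mult:
  assumes "i \<in> {1..n}" "j \<in> {1..n}" "i \<noteq> j"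
  shows "integrable M (\<lambda>\<omega>. p i \<omega> * p j \<omega>)" "expectation (\<lambda>\<omega>. p i \<omega> * p j \<omega>) = q i * q j"
proof -
  have "indep_var (Pi\<^sub>M {i} (\<lambda>_. borel)) (\<lambda>\<omega>. restrict (\<lambda>l. p l \<omega>) {i})
      (Pi\<^sub>M {j} (\<lambda>_. borel)) (\<lambda>\<omega>. restrict (\<lambda>l. p l \<omega>) {j})"
    using assms by (intro indep_var_restrict[OF p_indep]) auto
  then have "indep_var borel ((\<lambda>x. x i) \<circ> (\<lambda>\<omega>. restrict (\<lambda>l. p l \<omega>) {i}))
      borel ((\<lambda>x. x j) \<circ> (\<lambda>\<omega>. restrict (\<lambda>l. p l \<omega>) {j}))"
    by (rule indep_var_compose) auto
  then have ind: "indep_var borel (p i) borel (p j)" by (simp add: comp_def)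
  note int = p_integrable[OF assms(1)] p_integrable[OF assms(2)]
  show "integrable M (\<lambda>\<omega>. p i \<omega> * p j \<omega>)" by (rule indep_var_integrable[OF ind int])
  show "expectation (\<lambda>\<omega>. p i \<omega> * p j \<omega>) = q i * q j"
    unfolding q_eq[OF assms(1)] q_eq[OF assms(2)] by (rule indep_var_lebesgue_integral[OF ind int])
qed

context
  fixes \<sigma> :: "(nat \<Rightarrow> real) \<Rightarrow> nat \<Rightarrow> real"
  assumes feasible: "\<And>x. x \<in> realisations n \<Longrightarrow> feasible_schedule n r x (\<sigma> x)"
    and nonanticipative: "nonanticipative n \<sigma>"
    and policy_measurable: "\<And>j. j \<in> {1..n} \<Longrightarrow> (\<lambda>x. \<sigma> x j) \<in> borel_measurable (\<Pi>\<^sub>M i\<in>{1..n}. borel)"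
begin

lemma start_measurable [measurable]: "j \<in> {1..n} \<Longrightarrow> (\<lambda>\<omega>. \<sigma> (realised \<omega>) j) \<in> borel_measurable M"
  using policy_measurable measurable_compose[OF realised_measurable] by blast

lemma nn_integral_p_start:
  assumes i: "i \<in> {1..n}"
  shows "(\<integral>\<^sup>+\<omega>. ennreal (p i \<omega>) * ennreal (\<sigma> (realised \<omega>) i) \<partial>M) =
    ennreal (q i) * (\<integral>\<^sup>+\<omega>. ennreal (\<sigma> (realised \<omega>) i) \<partial>M)"
proof -
  let ?J = "{1..n} - {i}"
  have insert: "insert i ?J = {1..n}" using i by auto
  \<comment> \<open>The start time of \<open>i\<close> as a function of the other durations alone;
    independence of \<open>p i\<close> can be applied to it.\<close>
  define h where "h z = \<sigma> (z(i := 0)) i" for z :: "nat \<Rightarrow> real"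
  have "(\<lambda>z. z(i := 0)) \<in> measurable (Pi\<^sub>M ?J (\<lambda>_. borel)) (Pi\<^sub>M (insert i ?J) (\<lambda>_. borel))"
    by (rule measurable_fun_upd[where J = ?J]) auto
  then have [measurable]: "h \<in> borel_measurable (Pi\<^sub>M ?J (\<lambda>_. borel))"
    unfolding h_def insert using policy_measurable[OF i] by (rule measurable_compose)
  let ?R = "\<lambda>\<omega>. restrict (\<lambda>l. p l \<omega>) ?J"
  have [measurable]: "?R \<in> measurable M (Pi\<^sub>M ?J (\<lambda>_. borel))" by measurable
  have "AE \<omega> in M. h (?R \<omega>) = \<sigma> (realised \<omega>) i"
    using AE_p_nonneg
  proof eventually_elim
    case (elim \<omega>)
    have "(?R \<omega>)(i := 0) = (realised \<omega>)(i := 0)"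
      by (auto simp: realised_def fun_eq_iff)
    then show ?case
      unfolding h_def using start_time_independent[OF nonanticipative realised_in_realisations[OF elim] i]
      by simp
  qed
  then have eq: "AE \<omega> in M. ennreal (\<sigma> (realised \<omega>) i) = ennreal (h (?R \<omega>))"
    by (auto elim!: eventually_mono)
  have ind: "indep_var (Pi\<^sub>M {i} (\<lambda>_. borel)) (\<lambda>\<omega>. restrict (\<lambda>l. p l \<omega>) {i}) (Pi\<^sub>M ?J (\<lambda>_. borel)) ?R"
    using i by (intro indep_var_restrict[OF p_indep]) auto
  have "(\<integral>\<^sup>+\<omega>. ennreal (p i \<omega>) * ennreal (\<sigma> (realised \<omega>) i) \<partial>M) =
      (\<integral>\<^sup>+\<omega>. ennreal (p i \<omega>) * ennreal (h (?R \<omega>)) \<partial>M)"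
    using eq by (intro nn_integral_cong_AE) (auto elim!: eventually_mono)
  also have "\<dots> = (\<integral>\<^sup>+\<omega>. \<integral>\<^sup>+\<omega>'. ennreal (p i \<omega>) * ennreal (h (?R \<omega>')) \<partial>M \<partial>M)"
  proof -
    have "(\<lambda>(y, z). ennreal (y i) * ennreal (h z)) \<in>
        borel_measurable (Pi\<^sub>M {i} (\<lambda>_. borel) \<Otimes>\<^sub>M Pi\<^sub>M ?J (\<lambda>_. borel))"
      by measurable
    from indep_var_nn_integral[OF ind this] show ?thesis by simp
  qed
  also have "\<dots> = (\<integral>\<^sup>+\<omega>. ennreal (p i \<omega>) \<partial>M) * (\<integral>\<^sup>+\<omega>'. ennreal (h (?R \<omega>')) \<partial>M)"
  proof -
    have "(\<lambda>\<omega>. ennreal (h (?R \<omega>))) \<in> borel_measurable M" by measurable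
    then show ?thesis using i by (simp only: nn_integral_cmult) (simp add: nn_integral_multc)
  qed
  also have "(\<integral>\<^sup>+\<omega>'. ennreal (h (?R \<omega>')) \<partial>M) = (\<integral>\<^sup>+\<omega>. ennreal (\<sigma> (realised \<omega>) i) \<partial>M)"
    using eq by (intro nn_integral_cong_AE) (auto elim!: eventually_mono)
  finally show ?thesis using nn_integral_p[OF i] by simp
qed

text \<open>\<open>busy_moment i - (q i)\<^sup>2 / 2\<close> is \<open>q i\<close> times the start
  time of an uninterrupted run with the mean busy time of \<open>i\<close>. The random variable
  \<open>E\<close> mediates: its expectation is the left side, and almost surely it is at most the
  sum of the start times weighted by the processing times.\<close>

lemma prefix_bound:
  assumes k: "k \<le> n"
  shows "ennreal (\<Sum>i=1..k. busy_moment i - (q i)\<^sup>2 / 2) \<le>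
    (\<Sum>i=1..k. ennreal (q i) * (\<integral>\<^sup>+\<omega>. ennreal (\<sigma> (realised \<omega>) i) \<partial>M))"
proof -
  define A where "A = {1..k}"
  have A: "finite A" "A \<subseteq> {1..n}" using k by (auto simp: A_def)
  \<comment> \<open>Idle time grows strictly between busy periods, so \<open>u\<close> tells them apart; \<open>b i\<close> is the beginning of
    the busy period of \<open>i\<close>.\<close>
  define u where "u i = idle k (r i)" for i
  define b where "b i = u i + (\<Sum>l\<in>{l\<in>A. u l < u i}. q l)" for i
  have u0: "0 \<le> u i" if "i \<in> A" for i
    using sum_work_le[of A "r i"] release_nonneg[of i] that A by (auto simp: u_def idle_def A_def)
  have q0: "0 \<le> q i" if "i \<in> A" for i using q_pos[of i] that A by (auto simp: less_imp_le)
  have b0: "0 \<le> b i" if "i \<in> A" for i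
    unfolding b_def using u0[OF that] q0 by (intro add_nonneg_nonneg sum_nonneg) auto
  \<comment> \<open>If a job from an earlier busy period were unfinished at \<open>r i\<close>, no
    idle time would accrue between its release and \<open>r i\<close>, and the labels would agree.
    So all such jobs are complete at \<open>r i\<close>.\<close>
  have br: "b i \<le> r i" if i: "i \<in> A" for i
  proof -
    have "q l \<le> work l (r i)" if l: "l \<in> A" "u l < u i" for l
    proof (rule ccontr)
      assume "\<not> q l \<le> work l (r i)"
      have ln: "l \<in> {1..n}" "i \<in> {1..n}" using l i A by auto
      have lt: "r l \<le> r i"
        using idle_mono[OF k, of "r i" "r l"] release_nonneg[OF ln(2)] l(2) unfolding u_def
        by (cases "r l \<le> r i") auto
      have "idle k (r i) = idle k (r l)"
      proof (rule idle_pend)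
        fix t assume "r l \<le> t" "t < r i"
        then show "pend l t"
          using \<open>\<not> q l \<le> work l (r i)\<close> work_mono_time[of t "r i" l] by (auto simp: pend_def)
      qed (use l lt k in \<open>auto simp: A_def\<close>)
      then show False using l(2) by (simp add: u_def)
    qed
    then have "(\<Sum>l\<in>{l\<in>A. u l < u i}. q l) \<le> (\<Sum>l\<in>{l\<in>A. u l < u i}. work l (r i))"
      by (intro sum_mono) auto
    also have "\<dots> \<le> (\<Sum>l\<in>A. work l (r i))"
      using A by (intro sum_mono2) (auto simp: work_nonneg)
    finally show ?thesis by (simp add: b_def u_def idle_def A_def)
  qed
  \<comment> \<open>Only products of distinct jobs occur, so the expectation factorises by
    independence and no second moment enters.\<close>
  define E where "E \<omega> = (\<Sum>i\<in>A. p i \<omega> * b i) +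
      (\<Sum>i\<in>A. \<Sum>l\<in>A. if i \<noteq> l \<and> u i = u l then p i \<omega> * p l \<omega> else 0) / 2" for \<omega>
  have int: "integrable M (\<lambda>\<omega>. if i \<noteq> l \<and> u i = u l then p i \<omega> * p l \<omega> else 0)"
    if "i \<in> A" "l \<in> A" for i l
    using expectation_mult(1)[OF subsetD[OF A(2) that(1)] subsetD[OF A(2) that(2)]]
    by (cases "i \<noteq> l \<and> u i = u l") auto
  have int_b: "integrable M (\<lambda>\<omega>. p i \<omega> * b i)" if "i \<in> A" for i
    using p_integrable[OF subsetD[OF A(2) that]] by simp
  have int2: "integrable M (\<lambda>\<omega>. \<Sum>i\<in>A. p i \<omega> * b i)"
    by (rule Bochner_Integration.integrable_sum) (rule int_b)
  have int3: "integrable M (\<lambda>\<omega>. \<Sum>l\<in>A. if i \<noteq> l \<and> u i = u l then p i \<omega> * p l \<omega> else 0)"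
    if "i \<in> A" for i
    by (rule Bochner_Integration.integrable_sum) (rule int[OF that])
  have int4: "integrable M (\<lambda>\<omega>. (\<Sum>i\<in>A. \<Sum>l\<in>A. if i \<noteq> l \<and> u i = u l then p i \<omega> * p l \<omega> else 0) / 2)"
    by (intro integrable_divide_zero Bochner_Integration.integrable_sum int3)
  have intE: "integrable M E"
    unfolding E_def by (rule Bochner_Integration.integrable_add[OF int2 int4])
  have expE: "expectation E = (\<Sum>i\<in>A. q i * b i) +
      (\<Sum>i\<in>A. \<Sum>l\<in>A. if i \<noteq> l \<and> u i = u l then q i * q l else 0) / 2"
  proof -
    have exp_pair: "expectation (\<lambda>\<omega>. if i \<noteq> l \<and> u i = u l then p i \<omega> * p l \<omega> else 0) =
        (if i \<noteq> l \<and> u i = u l then q i * q l else 0)" if "i \<in> A" "l \<in> A" for i l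
      using expectation_mult(2)[OF subsetD[OF A(2) that(1)] subsetD[OF A(2) that(2)]]
      by (cases "i \<noteq> l \<and> u i = u l") auto
    have "expectation (\<lambda>\<omega>. \<Sum>i\<in>A. p i \<omega> * b i) = (\<Sum>i\<in>A. expectation (\<lambda>\<omega>. p i \<omega> * b i))"
      by (rule Bochner_Integration.integral_sum) (rule int_b)
    also have "\<dots> = (\<Sum>i\<in>A. q i * b i)"
      using q_eq A(2) by (intro sum.cong) auto
    finally have 1: "expectation (\<lambda>\<omega>. \<Sum>i\<in>A. p i \<omega> * b i) = (\<Sum>i\<in>A. q i * b i)" .
    have "expectation (\<lambda>\<omega>. \<Sum>i\<in>A. \<Sum>l\<in>A. if i \<noteq> l \<and> u i = u l then p i \<omega> * p l \<omega> else 0) =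
        (\<Sum>i\<in>A. expectation (\<lambda>\<omega>. \<Sum>l\<in>A. if i \<noteq> l \<and> u i = u l then p i \<omega> * p l \<omega> else 0))"
      by (rule Bochner_Integration.integral_sum) (rule int3)
    also have "\<dots> = (\<Sum>i\<in>A. \<Sum>l\<in>A. if i \<noteq> l \<and> u i = u l then q i * q l else 0)"
    proof (rule sum.cong)
      fix i assume i: "i \<in> A"
      have "expectation (\<lambda>\<omega>. \<Sum>l\<in>A. if i \<noteq> l \<and> u i = u l then p i \<omega> * p l \<omega> else 0) =
          (\<Sum>l\<in>A. expectation (\<lambda>\<omega>. if i \<noteq> l \<and> u i = u l then p i \<omega> * p l \<omega> else 0))"
        by (rule Bochner_Integration.integral_sum) (rule int[OF i])
      also have "\<dots> = (\<Sum>l\<in>A. if i \<noteq> l \<and> u i = u l then q i * q l else 0)"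
        by (rule sum.cong[OF refl]) (rule exp_pair[OF i])
      finally show "expectation (\<lambda>\<omega>. \<Sum>l\<in>A. if i \<noteq> l \<and> u i = u l then p i \<omega> * p l \<omega> else 0) =
          (\<Sum>l\<in>A. if i \<noteq> l \<and> u i = u l then q i * q l else 0)" .
    qed simp
    finally have 2: "expectation (\<lambda>\<omega>. \<Sum>i\<in>A. \<Sum>l\<in>A. if i \<noteq> l \<and> u i = u l then p i \<omega> * p l \<omega> else 0) =
        (\<Sum>i\<in>A. \<Sum>l\<in>A. if i \<noteq> l \<and> u i = u l then q i * q l else 0)" .
    show ?thesis
      unfolding E_def Bochner_Integration.integral_add[OF int2 int4] integral_divide_zero 1 2 ..
  qed
  have "(\<Sum>i\<in>A. busy_moment i - (q i)\<^sup>2 / 2) = expectation E"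
  proof -
    \<comment> \<open>The squared total is split by the order of the two labels. Pairs from
      different periods reproduce the sums inside \<open>b\<close>; the diagonal of the equal labels
      is the sum of squares subtracted on the left.\<close>
    have lin: "(if u l < u i then q l * q i else 0) + (if u i < u l then q i * q l else 0) +
        (if u i = u l then q i * q l else 0) = q i * q l" for i l
      by (auto simp: mult.commute)
    define X where "X = (\<Sum>i\<in>A. \<Sum>l\<in>A. if u l < u i then q l * q i else 0)"
    have swap: "X = (\<Sum>i\<in>A. \<Sum>l\<in>A. if u i < u l then q i * q l else 0)"
      unfolding X_def by (rule sum.swap)
    have "(\<Sum>i\<in>A. q i)\<^sup>2 = (\<Sum>i\<in>A. \<Sum>l\<in>A. (if u l < u i then q l * q i else 0) +
        (if u i < u l then q i * q l else 0) + (if u i = u l then q i * q l else 0))"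
      unfolding lin by (simp add: power2_eq_square sum_product)
    also have "\<dots> = X + X + (\<Sum>i\<in>A. \<Sum>l\<in>A. if u i = u l then q i * q l else 0)"
      unfolding sum.distrib X_def[symmetric] swap[symmetric] by simp
    also have "(\<Sum>i\<in>A. \<Sum>l\<in>A. if u i = u l then q i * q l else 0) =
        (\<Sum>i\<in>A. \<Sum>l\<in>A. (if i \<noteq> l \<and> u i = u l then q i * q l else 0) + (if l = i then q i * q l else 0))"
      by (intro sum.cong) auto
    also have "\<dots> = (\<Sum>i\<in>A. \<Sum>l\<in>A. if i \<noteq> l \<and> u i = u l then q i * q l else 0) + (\<Sum>i\<in>A. (q i)\<^sup>2)"
      using A by (simp add: sum.distrib power2_eq_square)
    finally have sq: "(\<Sum>i\<in>A. q i)\<^sup>2 = X + X +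
        ((\<Sum>i\<in>A. \<Sum>l\<in>A. if i \<noteq> l \<and> u i = u l then q i * q l else 0) + (\<Sum>i\<in>A. (q i)\<^sup>2))" .
    have "q i * b i = u i * q i + (\<Sum>l\<in>A. if u l < u i then q l * q i else 0)" for i
    proof -
      have "(\<Sum>l\<in>A. if u l < u i then q l * q i else 0) = (\<Sum>l\<in>{l\<in>A. u l < u i}. q l * q i)"
        by (rule sum.inter_filter[OF A(1), symmetric])
      then show ?thesis by (simp add: b_def sum_distrib_right[symmetric] algebra_simps)
    qed
    then have qb: "(\<Sum>i\<in>A. q i * b i) = (\<Sum>i\<in>A. u i * q i) + X"
      unfolding X_def by (simp add: sum.distrib)
    have "(\<Sum>i\<in>A. busy_moment i - (q i)\<^sup>2 / 2) = (\<Sum>i\<in>A. busy_moment i) - (\<Sum>i\<in>A. (q i)\<^sup>2) / 2"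
      by (simp add: sum_subtractf sum_divide_distrib)
    also have "(\<Sum>i\<in>A. busy_moment i) = (\<Sum>i\<in>A. u i * q i) + (\<Sum>i\<in>A. q i)\<^sup>2 / 2"
      unfolding u_def A_def by (rule busy_moment_prefix_sum[OF k])
    finally show ?thesis unfolding expE qb sq by (simp add: field_simps)
  qed
  then have "ennreal (\<Sum>i\<in>A. busy_moment i - (q i)\<^sup>2 / 2) = ennreal (expectation E)" by simp
  also have "\<dots> = (\<integral>\<^sup>+\<omega>. ennreal (E \<omega>) \<partial>M)"
  proof (rule nn_integral_eq_integral[symmetric, OF intE])
    show "AE \<omega> in M. 0 \<le> E \<omega>"
      using AE_p_nonneg
    proof eventually_elim
      case (elim \<omega>)
      then have pA: "0 \<le> p i \<omega>" if "i \<in> A" for i using subsetD[OF A(2) that] by blast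
      then show ?case unfolding E_def using b0
        by (intro add_nonneg_nonneg sum_nonneg divide_nonneg_pos mult_nonneg_nonneg) auto
    qed
  qed
  also have "\<dots> \<le> (\<integral>\<^sup>+\<omega>. (\<Sum>i\<in>A. ennreal (p i \<omega>) * ennreal (\<sigma> (realised \<omega>) i)) \<partial>M)"
  proof (rule nn_integral_mono_AE, use AE_p_nonneg in eventually_elim)
    case (elim \<omega>)
    have fs: "feasible_schedule n r (realised \<omega>) (\<sigma> (realised \<omega>))"
      using feasible realised_in_realisations[OF elim] by blast
    have pA: "0 \<le> p i \<omega>" and rS: "r i \<le> \<sigma> (realised \<omega>) i" and r0: "0 \<le> r i" if "i \<in> A" for i
      using elim fs subsetD[OF A(2) that] release_nonneg[of i]
      unfolding feasible_schedule_def by blast+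
    have "E \<omega> \<le> (\<Sum>i\<in>A. p i \<omega> * \<sigma> (realised \<omega>) i)"
      unfolding E_def
    proof (rule start_times_lower_bound[OF A(1)])
      show "b i \<le> \<sigma> (realised \<omega>) i" if "i \<in> A" for i using br[OF that] rS[OF that] by simp
      show "\<sigma> (realised \<omega>) i + p i \<omega> \<le> \<sigma> (realised \<omega>) l \<or> \<sigma> (realised \<omega>) l + p l \<omega> \<le> \<sigma> (realised \<omega>) i"
        if "i \<in> A" "l \<in> A" "i \<noteq> l" for i l
      proof -
        have "i \<in> {1..n}" "l \<in> {1..n}" using that A by auto
        then have "realised \<omega> i = p i \<omega>" "realised \<omega> l = p l \<omega>"
          "\<sigma> (realised \<omega>) i + realised \<omega> i \<le> \<sigma> (realised \<omega>) l \<or>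
            \<sigma> (realised \<omega>) l + realised \<omega> l \<le> \<sigma> (realised \<omega>) i"
          using fs that(3) unfolding feasible_schedule_def by (simp_all add: realised_def)
        then show ?thesis by simp
      qed
    qed (use pA in \<open>auto simp: b_def\<close>)
    then have "ennreal (E \<omega>) \<le> ennreal (\<Sum>i\<in>A. p i \<omega> * \<sigma> (realised \<omega>) i)" by (rule ennreal_leI)
    also have "\<dots> = (\<Sum>i\<in>A. ennreal (p i \<omega> * \<sigma> (realised \<omega>) i))"
      using pA rS r0 by (intro sum_ennreal[symmetric] mult_nonneg_nonneg) (auto intro: order_trans)
    also have "\<dots> = (\<Sum>i\<in>A. ennreal (p i \<omega>) * ennreal (\<sigma> (realised \<omega>) i))"
      using pA by (intro sum.cong refl ennreal_mult')
    finally show ?case .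
  qed
  also have "\<dots> = (\<Sum>i\<in>A. \<integral>\<^sup>+\<omega>. ennreal (p i \<omega>) * ennreal (\<sigma> (realised \<omega>) i) \<partial>M)"
    using A by (intro nn_integral_sum) auto
  also have "\<dots> = (\<Sum>i\<in>A. ennreal (q i) * (\<integral>\<^sup>+\<omega>. ennreal (\<sigma> (realised \<omega>) i) \<partial>M))"
    using A by (intro sum.cong refl nn_integral_p_start) auto
  finally show ?thesis by (simp add: A_def)
qed

lemma weighted_completion_lower_bound:
  assumes w: "\<And>j. j \<in> {1..n} \<Longrightarrow> 0 \<le> w j"
    and wspt_order: "\<And>i j. i \<in> {1..n} \<Longrightarrow> j \<in> {1..n} \<Longrightarrow> i \<le> j \<Longrightarrow> w i / q i \<ge> w j / q j"
  shows "ennreal (\<Sum>j=1..n. w j * (mean_busy_time q I j + q j / 2)) \<le>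
    (\<integral>\<^sup>+\<omega>. ennreal (\<Sum>j=1..n. w j * (\<sigma> (realised \<omega>) j + p j \<omega>)) \<partial>M)"
proof -
  let ?s = "\<lambda>j. \<integral>\<^sup>+\<omega>. ennreal (\<sigma> (realised \<omega>) j) \<partial>M"
  have q0: "0 < q j" if "j \<in> {1..n}" for j using q_pos[OF that] .
  \<comment> \<open>Each term becomes a start-time part, whose coefficient \<open>w j / q j\<close>
    is nonincreasing in \<open>j\<close>, plus the mean processing time.\<close>
  have "(\<Sum>j=1..n. w j * (mean_busy_time q I j + q j / 2)) =
      (\<Sum>j=1..n. w j / q j * (busy_moment j - (q j)\<^sup>2 / 2)) + (\<Sum>j=1..n. w j * q j)"
    unfolding sum.distrib[symmetric]
  proof (rule sum.cong)
    fix j assume "j \<in> {1..n}"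
    then show "w j * (mean_busy_time q I j + q j / 2) =
        w j / q j * (busy_moment j - (q j)\<^sup>2 / 2) + w j * q j"
      using q0[of j] mean_busy_time_eq[of j] by (simp add: field_simps power2_eq_square)
  qed simp
  then have "ennreal (\<Sum>j=1..n. w j * (mean_busy_time q I j + q j / 2)) \<le>
      ennreal (\<Sum>j=1..n. w j / q j * (busy_moment j - (q j)\<^sup>2 / 2)) + ennreal (\<Sum>j=1..n. w j * q j)"
    using ennreal_add_le by simp
  also have "ennreal (\<Sum>j=1..n. w j / q j * (busy_moment j - (q j)\<^sup>2 / 2)) \<le>
      (\<Sum>j=1..n. ennreal (w j / q j) * (ennreal (q j) * ?s j))"
    using w q0 wspt_order prefix_bound
    by (intro ennreal_weighted_sum_le) (auto simp: less_imp_le)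
  also have "\<dots> = (\<Sum>j=1..n. ennreal (w j) * ?s j)"
  proof (rule sum.cong)
    fix j assume j: "j \<in> {1..n}"
    have "ennreal (w j / q j) * ennreal (q j) = ennreal (w j)"
      using w[OF j] q0[OF j] by (simp add: ennreal_mult[symmetric])
    then show "ennreal (w j / q j) * (ennreal (q j) * ?s j) = ennreal (w j) * ?s j"
      by (simp add: mult.assoc[symmetric])
  qed simp
  also have "ennreal (\<Sum>j=1..n. w j * q j) = (\<Sum>j=1..n. ennreal (w j) * (\<integral>\<^sup>+\<omega>. ennreal (p j \<omega>) \<partial>M))"
  proof -
    have "ennreal (\<Sum>j=1..n. w j * q j) = (\<Sum>j=1..n. ennreal (w j * q j))"
      using w q0 by (intro sum_ennreal[symmetric]) (auto simp: less_imp_le)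
    also have "\<dots> = (\<Sum>j=1..n. ennreal (w j) * (\<integral>\<^sup>+\<omega>. ennreal (p j \<omega>) \<partial>M))"
      using w q0 by (intro sum.cong refl) (auto simp: nn_integral_p ennreal_mult')
    finally show ?thesis .
  qed
  also have "(\<Sum>j=1..n. ennreal (w j) * ?s j) + (\<Sum>j=1..n. ennreal (w j) * (\<integral>\<^sup>+\<omega>. ennreal (p j \<omega>) \<partial>M)) =
      (\<Sum>j=1..n. \<integral>\<^sup>+\<omega>. ennreal (w j) * (ennreal (\<sigma> (realised \<omega>) j) + ennreal (p j \<omega>)) \<partial>M)"
    unfolding sum.distrib[symmetric]
    by (intro sum.cong refl) (simp add: nn_integral_cmult nn_integral_add distrib_left)
  also have "\<dots> = (\<integral>\<^sup>+\<omega>. (\<Sum>j=1..n. ennreal (w j) * (ennreal (\<sigma> (realised \<omega>) j) + ennreal (p j \<omega>))) \<partial>M)"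
    by (intro nn_integral_sum[symmetric]) auto
  also have "\<dots> = (\<integral>\<^sup>+\<omega>. ennreal (\<Sum>j=1..n. w j * (\<sigma> (realised \<omega>) j + p j \<omega>)) \<partial>M)"
  proof (rule nn_integral_cong_AE, use AE_p_nonneg in eventually_elim)
    case (elim \<omega>)
    have S0: "0 \<le> \<sigma> (realised \<omega>) j" if "j \<in> {1..n}" for j
    proof -
      have "r j \<le> \<sigma> (realised \<omega>) j"
        using feasible[OF realised_in_realisations[OF elim]] that
        unfolding feasible_schedule_def by blast
      then show ?thesis using release_nonneg[OF that] by linarith
    qed
    have "ennreal (w j) * (ennreal (\<sigma> (realised \<omega>) j) + ennreal (p j \<omega>)) =
        ennreal (w j * (\<sigma> (realised \<omega>) j + p j \<omega>))" if j: "j \<in> {1..n}" for j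
      using S0[OF j] bspec[OF elim j] w[OF j] by (simp add: ennreal_mult ennreal_plus)
    then have "(\<Sum>j=1..n. ennreal (w j) * (ennreal (\<sigma> (realised \<omega>) j) + ennreal (p j \<omega>))) =
        (\<Sum>j=1..n. ennreal (w j * (\<sigma> (realised \<omega>) j + p j \<omega>)))" by (rule sum.cong[OF refl])
    also have "\<dots> = ennreal (\<Sum>j=1..n. w j * (\<sigma> (realised \<omega>) j + p j \<omega>))"
      using S0 elim w by (intro sum_ennreal mult_nonneg_nonneg add_nonneg_nonneg) auto
    finally show ?case .
  qed
  finally show ?thesis by (simp add: add_left_mono add_right_mono)
qed

end

text \<open>Every fixed seed gives a deterministic policy obeying the bound, and the seed is
  averaged over a probability measure.\<close>

lemma policy_cost_lower_bound:
  assumes w: "\<And>j. j \<in> {1..n} \<Longrightarrow> 0 \<le> w j"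
    and wspt_order: "\<And>i j. i \<in> {1..n} \<Longrightarrow> j \<in> {1..n} \<Longrightarrow> i \<le> j \<Longrightarrow> w i / q i \<ge> w j / q j"
    and P: "scheduling_policy n r P"
  shows "ennreal (\<Sum>j=1..n. w j * (mean_busy_time q I j + q j / 2)) \<le> policy_cost M n w p P"
proof -
  let ?K = "ennreal (\<Sum>j=1..n. w j * (mean_busy_time q I j + q j / 2))"
  let ?U = "uniform_measure lborel {0..1::real}"
  interpret U: prob_space ?U by (rule prob_space_uniform_measure) auto
  have "?K = (\<integral>\<^sup>+u. ?K \<partial>?U)" by (simp add: U.emeasure_space_1)
  also have "\<dots> \<le> policy_cost M n w p P"
    unfolding policy_cost_def
  proof (rule nn_integral_mono)
    fix u :: real
    have meas: "(\<lambda>x. P u x j) \<in> borel_measurable (\<Pi>\<^sub>M i\<in>{1..n}. borel)" if "j \<in> {1..n}" for j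
    proof -
      have "(\<lambda>(u, x). P u x j) \<in> borel_measurable (borel \<Otimes>\<^sub>M (\<Pi>\<^sub>M i\<in>{1..n}. borel))"
        using P that unfolding scheduling_policy_def by blast
      from measurable_Pair2[OF this, of u] show ?thesis by simp
    qed
    have "?K \<le> (\<integral>\<^sup>+\<omega>. ennreal (\<Sum>j=1..n. w j * (P u (realised \<omega>) j + p j \<omega>)) \<partial>M)"
      using P meas w wspt_order unfolding scheduling_policy_def
      by (intro weighted_completion_lower_bound) auto
    then show "?K \<le> (\<integral>\<^sup>+\<omega>. ennreal (\<Sum>j=1..n. w j * (P u (\<lambda>i\<in>{1..n}. p i \<omega>) j + p j \<omega>)) \<partial>M)"
      by (simp add: realised_def)
  qed
  finally show ?thesis .
qed

end

section \<open>Upper bound for RSOS\<close>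

locale rsos_setting = stochastic_instance M n r q I p
  for M :: "'a measure" and n :: nat and r q :: "nat \<Rightarrow> real" and I :: "nat \<Rightarrow> real \<Rightarrow> real"
    and p :: "nat \<Rightarrow> 'a \<Rightarrow> real" +
  fixes \<alpha> :: "nat \<Rightarrow> 'a \<Rightarrow> real" and f :: "real \<Rightarrow> real" and \<Delta> c :: real
  assumes p_square_integrable: "j \<in> {1..n} \<Longrightarrow> integrable M (\<lambda>\<omega>. (p j \<omega>)\<^sup>2)"
    and cv_le: "j \<in> {1..n} \<Longrightarrow> cv_squared M (p j) \<le> \<Delta>"
    and density: "unit_density f"
    and alpha_distributed: "j \<in> {1..n} \<Longrightarrow>
      distributed M lborel (\<alpha> j) (\<lambda>x. ennreal (f x * indicator {0<..1} x))"
    and indep: "indep_vars (\<lambda>_. borel) (case_sum p \<alpha>) ({1..n} <+> {1..n})"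
    and condition1: "x \<in> {0<..1} \<Longrightarrow>
      (LBINT a:{0<..x}. (1 - gfun \<Delta> * (x - a)) * f a) \<le> (c - 1) * x"
    and condition2: "x \<in> {0<..1} \<Longrightarrow>
      (2 - gfun \<Delta> * (1 - (LBINT a:{0<..1}. a * f a))) * (LBINT a:{1-x<..1}. f a) \<le> c * x"
begin

section \<open>The law of a single draw and the two conditions on it\<close>

definition D :: "real measure" where
  "D = density lborel (\<lambda>x. ennreal (f x * indicator {0<..1} x))"

lemma density_measurable [measurable]: "(\<lambda>x. f x * indicator {0<..1} x) \<in> borel_measurable borel"
  using density by (auto simp: unit_density_def set_integrable_def mult.commute dest: borel_measurable_integrable)

lemma density_nonneg: "0 \<le> f x * indicator {0<..1} x"
  using density by (auto simp: unit_density_def indicator_def)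

lemma sets_D [simp, measurable_cong]: "sets D = sets borel" and space_D [simp]: "space D = UNIV"
  by (simp_all add: D_def)

lemma nn_integral_alpha:
  assumes "j \<in> {1..n}" "h \<in> borel_measurable borel"
  shows "(\<integral>\<^sup>+\<omega>. h (\<alpha> j \<omega>) \<partial>M) = (\<integral>\<^sup>+a. h a \<partial>D)"
  unfolding D_def using distributed_nn_integral[OF alpha_distributed[OF assms(1)], of h] assms(2)
  by (subst nn_integral_density) auto

lemma alpha_measurable [measurable]: "j \<in> {1..n} \<Longrightarrow> \<alpha> j \<in> borel_measurable M"
  using distributed_measurable[OF alpha_distributed] by simp

lemma integral_D:
  assumes "h \<in> borel_measurable borel"
  shows "(\<integral>a. h a \<partial>D) = (LBINT a:{0<..1}. h a * f a)"
proof -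
  have "(\<integral>a. h a \<partial>D) = (\<integral>a. (f a * indicator {0<..1} a) * h a \<partial>lborel)"
    unfolding D_def using assms density_nonneg by (intro integral_real_density) auto
  then show ?thesis unfolding set_lebesgue_integral_def by (simp add: mult_ac)
qed

sublocale D: prob_space D
proof
  have int: "integrable lborel (\<lambda>x. f x * indicator {0<..1} x)"
    using density by (simp add: unit_density_def set_integrable_def mult.commute)
  have "emeasure D (space D) = (\<integral>\<^sup>+x. ennreal (f x * indicator {0<..1} x) \<partial>lborel)"
    by (simp add: D_def emeasure_density)
  also have "\<dots> = ennreal (\<integral>x. f x * indicator {0<..1} x \<partial>lborel)"
    using int density_nonneg by (intro nn_integral_eq_integral) auto
  also have "(\<integral>x. f x * indicator {0<..1} x \<partial>lborel) = 1"
    using density by (simp add: unit_density_def set_lebesgue_integral_def mult.commute)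
  finally show "emeasure D (space D) = 1" by simp
qed

lemma prob_D_UNIV [simp]: "D.prob UNIV = 1"
  using D.prob_space by simp

lemma AE_D: "AE a in D. 0 < a \<and> a \<le> 1"
  unfolding D_def by (subst AE_density) (auto split: split_indicator intro!: AE_I2)

lemma AE_alpha: "j \<in> {1..n} \<Longrightarrow> AE \<omega> in M. 0 < \<alpha> j \<omega> \<and> \<alpha> j \<omega> \<le> 1"
  using distributed_AE2[OF alpha_distributed, of j "\<lambda>a. 0 < a \<and> a \<le> 1"]
  by (auto simp: indicator_def intro!: AE_I2)

lemma D_integrable:
  assumes [measurable]: "h \<in> borel_measurable borel" and "\<And>a. 0 < a \<Longrightarrow> a \<le> 1 \<Longrightarrow> \<bar>h a\<bar> \<le> B"
  shows "integrable D (h :: real \<Rightarrow> real)"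
proof (rule D.integrable_const_bound[where B = B])
  show "AE a in D. norm (h a) \<le> B" using AE_D by (rule eventually_mono) (use assms in auto)
qed measurable

definition mu :: real where "mu = (\<integral>a. a \<partial>D)"

lemma mu_bounds: "0 \<le> mu" "mu \<le> 1"
proof -
  have int: "integrable D (\<lambda>a. a)" by (rule D_integrable[where B = 1]) auto
  show "0 \<le> mu" unfolding mu_def by (rule integral_nonneg_AE) (use AE_D in \<open>auto elim!: eventually_mono\<close>)
  have "mu \<le> (\<integral>a. 1 \<partial>D)" unfolding mu_def
    using int AE_D by (intro integral_mono_AE) (auto elim!: eventually_mono)
  then show "mu \<le> 1" by (simp add: D.prob_space)
qed

text \<open>\<open>H x\<close> bounds the expected delay, in units of \<open>q k\<close>, caused by a job \<open>k\<close> of which the fraction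
  \<open>x\<close> is done when \<open>j\<close> enters the queue.\<close>

definition H :: "real \<Rightarrow> real" where
  "H x = (\<integral>a. indicator {..x} a * (1 - gfun \<Delta> * (x - a)) \<partial>D)"

lemma H_le:
  assumes "0 \<le> x" "x \<le> 1"
  shows "H x \<le> (c - 1) * x"
proof -
  have "H x = (LBINT a:{0<..x}. (1 - gfun \<Delta> * (x - a)) * f a)"
    unfolding H_def set_lebesgue_integral_def using assms
    by (subst integral_D, simp, unfold set_lebesgue_integral_def,
        intro Bochner_Integration.integral_cong) (auto simp: indicator_def)
  then show ?thesis using condition1[of x] assms
    by (cases "x = 0") (auto simp: set_lebesgue_integral_def)
qed

lemma H_1: "H 1 = 1 - gfun \<Delta> * (1 - mu)"
proof -
  have int: "integrable D (\<lambda>a. a)" by (rule D_integrable[where B = 1]) auto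
  have "H 1 = (\<integral>a. 1 - gfun \<Delta> * (1 - a) \<partial>D)"
    unfolding H_def
    by (intro integral_cong_AE eventually_mono[OF AE_D]) auto
  also have "\<dots> = 1 - gfun \<Delta> * (1 - mu)"
    using int by (simp add: mu_def D.prob_space)
  finally show ?thesis .
qed

lemma H_0: "H 0 = 0"
  unfolding H_def using AE_D
  by (intro integral_eq_zero_AE) (auto simp: indicator_def elim!: eventually_mono)

text \<open>This is \<open>condition2\<close> at \<open>x = 1 - m\<close>, whose first factor equals
  \<open>1 + H 1\<close>. At \<open>m = 1\<close>, outside the range of the condition, both sides
  vanish.\<close>

lemma prob_alpha_greater_le:
  assumes "0 \<le> m" "m \<le> 1"
  shows "(1 + H 1) * (\<integral>a. indicator {m<..} a \<partial>D) \<le> c * (1 - m)"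
proof -
  have eq: "(\<integral>a. indicator {m<..} a \<partial>D) = (LBINT a:{m<..1}. f a)"
    by (subst integral_D, simp, unfold set_lebesgue_integral_def,
        intro Bochner_Integration.integral_cong) (use assms in \<open>auto simp: indicator_def\<close>)
  have mu: "mu = (LBINT a:{0<..1}. a * f a)" unfolding mu_def by (subst integral_D) auto
  show ?thesis
  proof (cases "m = 1")
    case True
    then show ?thesis unfolding eq by (simp add: set_lebesgue_integral_def)
  next
    case False
    then show ?thesis using condition2[of "1 - m"] assms
      unfolding eq H_1 mu by (simp add: algebra_simps)
  qed
qed

lemma one_plus_H_le: "1 + H 1 \<le> c"
proof -
  have "AE a in D. indicator {0<..} a = (1::real)" using AE_D by (auto elim!: eventually_mono)
  then have "(\<integral>a. indicator {0<..} a \<partial>D) = (\<integral>a. 1 \<partial>D :: real)"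
    by (intro integral_cong_AE) auto
  then show ?thesis using prob_alpha_greater_le[of 0] by (simp add: D.prob_space)
qed

section \<open>Expected delay of one job caused by another\<close>

lemma Delta_nonneg: "j \<in> {1..n} \<Longrightarrow> 0 \<le> \<Delta>"
  using cv_le[of j] variance_positive[of "p j"] unfolding cv_squared_def
  by (meson order_trans zero_le_divide_iff zero_le_power2)

lemma nn_integral_excess_le:
  assumes k: "k \<in> {1..n}" and y: "0 \<le> y" "y \<le> q k"
  shows "(\<integral>\<^sup>+\<omega>. ennreal (max 0 (p k \<omega> - y)) \<partial>M) \<le> ennreal (q k - gfun \<Delta> * y)"
proof -
  have qk: "0 < q k" using q_pos[OF k] .
  have "(\<integral>\<^sup>+\<omega>. ennreal (max 0 (p k \<omega> - y)) \<partial>M) = ennreal (expectation (\<lambda>\<omega>. max 0 (p k \<omega> - y)))"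
    using p_integrable[OF k] by (intro nn_integral_eq_integral) auto
  also have "expectation (\<lambda>\<omega>. max 0 (p k \<omega> - y)) \<le> q k * (1 - gfun \<Delta> * (y / q k))"
    using expectation_excess_le[OF p_nonneg[OF k] p_integrable[OF k] p_square_integrable[OF k]
        q_eq[OF k] qk cv_le[OF k], of "y / q k"] y qk by simp
  also have "\<dots> = q k - gfun \<Delta> * y" using qk by (simp add: field_simps)
  finally show ?thesis by (simp add: ennreal_leI)
qed

text \<open>The summand in \<open>rsos_completion_le\<close>, with \<open>entry\<close> in place of
  the \<alpha>-point for the sake of measurability.\<close>

definition delay :: "nat \<Rightarrow> nat \<Rightarrow> 'a \<Rightarrow> real" where
  "delay j k \<omega> = (if \<alpha> k \<omega> * q k \<le> work k (entry j (\<alpha> j \<omega>))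
     then max 0 (p k \<omega> - (work k (entry j (\<alpha> j \<omega>)) - \<alpha> k \<omega> * q k)) else 0)"

lemma delay_measurable [measurable]:
  assumes j: "j \<in> {1..n}" and k: "k \<in> {1..n}"
  shows "delay j k \<in> borel_measurable M"
proof -
  note [measurable] = entry_measurable[OF j]
  show ?thesis unfolding delay_def using j k by measurable
qed

text \<open>Two draws and one processing time determine the delay, and they are independent.
  Integrating out \<open>p k\<close> by the excess bound and then the draw of \<open>k\<close>
  produces \<open>H\<close>; the draw of \<open>j\<close>, which fixes how much of \<open>k\<close>
  is done, remains.\<close>

lemma nn_integral_delay_le:
  assumes j: "j \<in> {1..n}" and k: "k \<in> {1..n}" and ne: "j \<noteq> k"
  shows "(\<integral>\<^sup>+\<omega>. ennreal (delay j k \<omega>) \<partial>M) \<le>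
    (\<integral>\<^sup>+a. ennreal (q k * H (work k (entry j a) / q k)) \<partial>D)"
proof -
  note [measurable] = entry_measurable[OF j]
  have qk: "0 < q k" using q_pos[OF k] .
  define h where "h = (\<lambda>(a, b, x). ennreal (if b * q k \<le> work k (entry j a)
     then max 0 (x - (work k (entry j a) - b * q k)) else 0))"
  have [measurable]: "h \<in> borel_measurable (borel \<Otimes>\<^sub>M borel \<Otimes>\<^sub>M borel)"
    unfolding h_def by measurable
  have [measurable]: "(\<lambda>a. \<integral>\<^sup>+b. \<integral>\<^sup>+\<omega>. h (a, b, p k \<omega>) \<partial>M \<partial>D) \<in> borel_measurable borel"
    "\<And>a. (\<lambda>b. \<integral>\<^sup>+\<omega>. h (a, b, p k \<omega>) \<partial>M) \<in> borel_measurable borel"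
    using k by measurable
  have "(\<integral>\<^sup>+\<omega>. ennreal (delay j k \<omega>) \<partial>M) = (\<integral>\<^sup>+\<omega>. h (case_sum p \<alpha> (Inr j) \<omega>, case_sum p \<alpha> (Inr k) \<omega>, case_sum p \<alpha> (Inl k) \<omega>) \<partial>M)"
    by (simp add: h_def delay_def)
  also have "\<dots> = (\<integral>\<^sup>+\<omega>. \<integral>\<^sup>+\<omega>'. \<integral>\<^sup>+\<omega>''. h (case_sum p \<alpha> (Inr j) \<omega>, case_sum p \<alpha> (Inr k) \<omega>', case_sum p \<alpha> (Inl k) \<omega>'') \<partial>M \<partial>M \<partial>M)"
    by (rule indep_vars_nn_integral_triple[OF indep]) (use j k ne in auto)
  also have "\<dots> = (\<integral>\<^sup>+\<omega>. \<integral>\<^sup>+b. \<integral>\<^sup>+\<omega>''. h (\<alpha> j \<omega>, b, p k \<omega>'') \<partial>M \<partial>D \<partial>M)"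
    using nn_integral_alpha[OF k, of "\<lambda>b. \<integral>\<^sup>+\<omega>''. h (a, b, p k \<omega>'') \<partial>M" for a] by simp
  also have "\<dots> = (\<integral>\<^sup>+a. \<integral>\<^sup>+b. \<integral>\<^sup>+\<omega>''. h (a, b, p k \<omega>'') \<partial>M \<partial>D \<partial>D)"
    by (rule nn_integral_alpha[OF j]) simp
  also have "\<dots> \<le> (\<integral>\<^sup>+a. ennreal (q k * H (work k (entry j a) / q k)) \<partial>D)"
  proof (intro nn_integral_mono)
    fix a :: real
    define W where "W = work k (entry j a)"
    have W: "0 \<le> W" "W \<le> q k" unfolding W_def using work_nonneg work_le[OF k] by auto
    have g: "0 \<le> gfun \<Delta>" "gfun \<Delta> \<le> 1" using gfun_bounds[OF Delta_nonneg[OF j]] by auto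
    \<comment> \<open>These bounds make the integrand integrable and nonnegative, so that the
      integral over the draw of \<open>k\<close> can be read as a real one.\<close>
    have bound: "0 \<le> q k - gfun \<Delta> * (W - b * q k) \<and> q k - gfun \<Delta> * (W - b * q k) \<le> q k"
      if "0 < b" "b * q k \<le> W" for b
    proof -
      have "0 \<le> b * q k" using that qk by simp
      then have "W - b * q k \<le> q k" using W by linarith
      then have "gfun \<Delta> * (W - b * q k) \<le> 1 * q k" using g qk that by (intro mult_mono) auto
      then show ?thesis using g that by simp
    qed
    have "(\<integral>\<^sup>+b. \<integral>\<^sup>+\<omega>. h (a, b, p k \<omega>) \<partial>M \<partial>D) \<le>
      (\<integral>\<^sup>+b. ennreal (indicator {..W / q k} b * (q k - gfun \<Delta> * (W - b * q k))) \<partial>D)"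
    proof (rule nn_integral_mono_AE, rule eventually_mono[OF AE_D])
      fix b :: real assume b: "0 < b \<and> b \<le> 1"
      show "(\<integral>\<^sup>+\<omega>. h (a, b, p k \<omega>) \<partial>M) \<le>
          ennreal (indicator {..W / q k} b * (q k - gfun \<Delta> * (W - b * q k)))"
      proof (cases "b * q k \<le> W")
        case True
        moreover have "0 \<le> b * q k" using b qk by simp
        ultimately show ?thesis
          using nn_integral_excess_le[OF k, of "W - b * q k"] W qk
          by (simp add: h_def W_def[symmetric] pos_le_divide_eq)
      qed (simp add: h_def W_def[symmetric])
    qed
    also have "\<dots> = ennreal (\<integral>b. indicator {..W / q k} b * (q k - gfun \<Delta> * (W - b * q k)) \<partial>D)"
    proof (rule nn_integral_eq_integral)
      show "integrable D (\<lambda>b. indicator {..W / q k} b * (q k - gfun \<Delta> * (W - b * q k)))"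
        using bound qk by (intro D_integrable[where B = "q k"]) (auto simp: indicator_def pos_le_divide_eq)
      show "AE b in D. 0 \<le> indicator {..W / q k} b * (q k - gfun \<Delta> * (W - b * q k))"
        using AE_D by (rule eventually_mono) (use bound qk in \<open>auto simp: indicator_def pos_le_divide_eq\<close>)
    qed
    also have "(\<integral>b. indicator {..W / q k} b * (q k - gfun \<Delta> * (W - b * q k)) \<partial>D) = q k * H (W / q k)"
      unfolding H_def integral_mult_right_zero[symmetric]
      by (intro Bochner_Integration.integral_cong) (use qk in \<open>auto simp: field_simps\<close>)
    finally show "(\<integral>\<^sup>+b. \<integral>\<^sup>+\<omega>. h (a, b, p k \<omega>) \<partial>M \<partial>D) \<le> ennreal (q k * H (work k (entry j a) / q k))"
      by (simp add: W_def)
  qed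
  finally show ?thesis .
qed


lemma mu_le_H_1:
  assumes "j \<in> {1..n}"
  shows "mu \<le> H 1"
proof -
  have "gfun \<Delta> * (1 - mu) \<le> 1 * (1 - mu)"
    using gfun_bounds[OF Delta_nonneg[OF assms]] mu_bounds by (intro mult_right_mono) auto
  then show ?thesis by (simp add: H_1)
qed

text \<open>Delay per unit of work received. For \<open>k < j\<close> the fraction done is 0 or 1,
  where \<open>H\<close> agrees with its chord of slope \<open>H 1\<close>; for \<open>k > j\<close>
  the slope \<open>c - 1\<close> comes from \<open>condition1\<close>.\<close>

definition coeff :: "nat \<Rightarrow> nat \<Rightarrow> real" where
  "coeff j k = (if k < j then H 1 else c - 1)"

lemma coeff_nonneg: "j \<in> {1..n} \<Longrightarrow> 0 \<le> coeff j k"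
  using mu_le_H_1[of j] mu_bounds one_plus_H_le by (auto simp: coeff_def)

lemma delay_bound:
  assumes j: "j \<in> {1..n}" and k: "k \<in> {1..n}" and ne: "j \<noteq> k" and a: "0 < a" "a \<le> 1"
  shows "q k * H (work k (entry j a) / q k) \<le> coeff j k * work k (entry j a)"
proof (cases "k < j")
  case True
  then have "work k (entry j a) = 0 \<or> work k (entry j a) = q k"
    using higher_priority_work_cases[OF j _ a, of k] k by (auto simp: entry_eq a)
  then show ?thesis using q_pos[OF k] True by (auto simp: coeff_def H_0)
next
  case False
  let ?W = "work k (entry j a)"
  have "q k * H (?W / q k) \<le> q k * ((c - 1) * (?W / q k))"
    using work_nonneg[of k] work_le[OF k] q_pos[OF k]
    by (intro mult_left_mono H_le) auto
  also have "\<dots> = coeff j k * ?W" using q_pos[OF k] False by (simp add: coeff_def)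
  finally show ?thesis .
qed

text \<open>By \<open>alpha_point_eq\<close> the entry time contains the idle time once, and the
  jobs of larger index add at most \<open>c - 1\<close> times it. Each \<open>k < j\<close> counts
  once in the entry time and \<open>H 1\<close> times as delay, and only if the draw exceeds the
  fraction of \<open>j\<close> done at \<open>r k\<close>.\<close>

lemma entry_plus_delays_le:
  assumes j: "j \<in> {1..n}" and a: "0 < a" "a \<le> 1"
  shows "entry j a + (\<Sum>k\<in>{1..n} - {j}. coeff j k * work k (entry j a)) \<le>
    c * idle j (r j) + a * q j +
    (\<Sum>k=1..<j. (1 + H 1) * q k * indicator {work j (r k) / q j<..} a)"
proof -
  let ?W = "\<lambda>k. work k (entry j a)"
  have c: "0 \<le> c - 1" and h: "0 \<le> 1 + H 1"
    using coeff_nonneg[OF j, of j] mu_le_H_1[OF j] mu_bounds by (auto simp: coeff_def)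
  have split: "{1..n} - {j} = {1..<j} \<union> {Suc j..n}" using j by auto
  have "(\<Sum>k\<in>{1..n} - {j}. coeff j k * ?W k) =
      (\<Sum>k=1..<j. coeff j k * ?W k) + (\<Sum>k=Suc j..n. coeff j k * ?W k)"
    unfolding split by (rule sum.union_disjoint) auto
  also have "(\<Sum>k=1..<j. coeff j k * ?W k) = (\<Sum>k=1..<j. H 1 * ?W k)"
    by (intro sum.cong) (auto simp: coeff_def)
  also have "(\<Sum>k=Suc j..n. coeff j k * ?W k) = (c - 1) * (\<Sum>k=Suc j..n. ?W k)"
    by (auto simp: sum_distrib_left coeff_def intro!: sum.cong)
  also have "(c - 1) * (\<Sum>k=Suc j..n. ?W k) \<le> (c - 1) * idle j (r j)"
    using lower_priority_work_le[OF j a] c by (intro mult_left_mono) (simp_all add: entry_eq a)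
  finally have "entry j a + (\<Sum>k\<in>{1..n} - {j}. coeff j k * ?W k) \<le>
      c * idle j (r j) + a * q j + ((\<Sum>k=1..<j. ?W k) + (\<Sum>k=1..<j. H 1 * ?W k))"
    using alpha_point_eq[OF j a] by (simp add: entry_eq a algebra_simps)
  also have "(\<Sum>k=1..<j. ?W k) + (\<Sum>k=1..<j. H 1 * ?W k) = (\<Sum>k=1..<j. (1 + H 1) * ?W k)"
    by (simp add: sum.distrib[symmetric] algebra_simps)
  also have "\<dots> \<le> (\<Sum>k=1..<j. (1 + H 1) * q k * indicator {work j (r k) / q j<..} a)"
  proof (rule sum_mono)
    fix k assume k: "k \<in> {1..<j}"
    then have "0 < q k" using q_pos[of k] j by auto
    then show "(1 + H 1) * ?W k \<le> (1 + H 1) * q k * indicator {work j (r k) / q j<..} a"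
      using higher_priority_work_cases[OF j k a] h q_pos[OF j]
      by (auto simp: entry_eq a pos_divide_less_eq indicator_def)
  qed
  finally show ?thesis by simp
qed

section \<open>Expected completion times under RSOS\<close>

lemma rsos_job_bound:
  assumes j: "j \<in> {1..n}"
  shows "(\<integral>\<^sup>+\<omega>. ennreal (p j \<omega> + entry j (\<alpha> j \<omega>) + (\<Sum>k\<in>{1..n} - {j}. delay j k \<omega>)) \<partial>M) \<le>
    ennreal (c * (mean_busy_time q I j + q j / 2))"
proof -
  note [measurable] = entry_measurable[OF j] delay_measurable[OF j]
  have qj: "0 < q j" using q_pos[OF j] .
  define u where "u k = work j (r k) / q j" for k
  have u: "0 \<le> u k" "u k \<le> 1" for k
    using work_nonneg work_le[OF j] qj by (auto simp: u_def)
  define R where "R a = c * idle j (r j) + a * q j +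
      (\<Sum>k=1..<j. (1 + H 1) * q k * indicator {u k<..} a)" for a
  have idle0: "0 \<le> idle j (r j)"
    using sum_work_le[of "{1..j}" "r j"] release_nonneg[OF j] j by (auto simp: idle_def)
  have c: "1 \<le> c" using one_plus_H_le mu_le_H_1[OF j] mu_bounds by linarith
  have h: "0 \<le> H 1" using mu_le_H_1[OF j] mu_bounds by linarith
  have [simp]: "integrable D (\<lambda>a. a)" by (rule D_integrable[where B = 1]) auto
  have [simp]: "integrable D (indicator {u k<..} :: real \<Rightarrow> real)" for k
    by (intro D_integrable[where B = 1]) (auto simp: indicator_def)
  have intR: "integrable D R"
    unfolding R_def by (intro Bochner_Integration.integrable_add Bochner_Integration.integrable_sum) auto
  have "(\<integral>\<^sup>+\<omega>. ennreal (p j \<omega> + entry j (\<alpha> j \<omega>) + (\<Sum>k\<in>{1..n} - {j}. delay j k \<omega>)) \<partial>M) \<le>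
      (\<integral>\<^sup>+\<omega>. ennreal (p j \<omega>) + (ennreal (entry j (\<alpha> j \<omega>)) + (\<Sum>k\<in>{1..n} - {j}. ennreal (delay j k \<omega>))) \<partial>M)"
  proof (rule nn_integral_mono)
    fix \<omega>
    have "ennreal (p j \<omega> + (entry j (\<alpha> j \<omega>) + (\<Sum>k\<in>{1..n} - {j}. delay j k \<omega>))) \<le>
        ennreal (p j \<omega>) + ennreal (entry j (\<alpha> j \<omega>) + (\<Sum>k\<in>{1..n} - {j}. delay j k \<omega>))"
      by (rule ennreal_add_le)
    also have "\<dots> \<le> ennreal (p j \<omega>) + (ennreal (entry j (\<alpha> j \<omega>)) + ennreal (\<Sum>k\<in>{1..n} - {j}. delay j k \<omega>))"
      by (rule add_left_mono) (rule ennreal_add_le)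
    also have "\<dots> \<le> ennreal (p j \<omega>) + (ennreal (entry j (\<alpha> j \<omega>)) + (\<Sum>k\<in>{1..n} - {j}. ennreal (delay j k \<omega>)))"
      by (intro add_left_mono ennreal_sum_le)
    finally show "ennreal (p j \<omega> + entry j (\<alpha> j \<omega>) + (\<Sum>k\<in>{1..n} - {j}. delay j k \<omega>)) \<le>
        ennreal (p j \<omega>) + (ennreal (entry j (\<alpha> j \<omega>)) + (\<Sum>k\<in>{1..n} - {j}. ennreal (delay j k \<omega>)))"
      by (simp only: add.assoc)
  qed
  also have "\<dots> = (\<integral>\<^sup>+\<omega>. ennreal (p j \<omega>) \<partial>M) + ((\<integral>\<^sup>+\<omega>. ennreal (entry j (\<alpha> j \<omega>)) \<partial>M) +
      (\<Sum>k\<in>{1..n} - {j}. \<integral>\<^sup>+\<omega>. ennreal (delay j k \<omega>) \<partial>M))"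
  proof -
    have "(\<integral>\<^sup>+\<omega>. (\<Sum>k\<in>{1..n} - {j}. ennreal (delay j k \<omega>)) \<partial>M) =
        (\<Sum>k\<in>{1..n} - {j}. \<integral>\<^sup>+\<omega>. ennreal (delay j k \<omega>) \<partial>M)"
      by (rule nn_integral_sum) auto
    then show ?thesis using j by (simp add: nn_integral_add)
  qed
  also have "(\<integral>\<^sup>+\<omega>. ennreal (p j \<omega>) \<partial>M) = ennreal (q j)"
    by (rule nn_integral_p[OF j])
  also have "(\<integral>\<^sup>+\<omega>. ennreal (entry j (\<alpha> j \<omega>)) \<partial>M) = (\<integral>\<^sup>+a. ennreal (entry j a) \<partial>D)"
    by (rule nn_integral_alpha[OF j]) simp
  also have "(\<Sum>k\<in>{1..n} - {j}. \<integral>\<^sup>+\<omega>. ennreal (delay j k \<omega>) \<partial>M) \<le>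
      (\<Sum>k\<in>{1..n} - {j}. \<integral>\<^sup>+a. ennreal (coeff j k * work k (entry j a)) \<partial>D)"
  proof (rule sum_mono)
    fix k assume k: "k \<in> {1..n} - {j}"
    then have "(\<integral>\<^sup>+\<omega>. ennreal (delay j k \<omega>) \<partial>M) \<le> (\<integral>\<^sup>+a. ennreal (q k * H (work k (entry j a) / q k)) \<partial>D)"
      using j by (intro nn_integral_delay_le) auto
    also have "\<dots> \<le> (\<integral>\<^sup>+a. ennreal (coeff j k * work k (entry j a)) \<partial>D)"
      using k j delay_bound[of j k]
      by (intro nn_integral_mono_AE eventually_mono[OF AE_D] ennreal_leI) auto
    finally show "(\<integral>\<^sup>+\<omega>. ennreal (delay j k \<omega>) \<partial>M) \<le>
      (\<integral>\<^sup>+a. ennreal (coeff j k * work k (entry j a)) \<partial>D)" .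
  qed
  also have "(\<integral>\<^sup>+a. ennreal (entry j a) \<partial>D) +
      (\<Sum>k\<in>{1..n} - {j}. \<integral>\<^sup>+a. ennreal (coeff j k * work k (entry j a)) \<partial>D) =
      (\<integral>\<^sup>+a. ennreal (entry j a) + (\<Sum>k\<in>{1..n} - {j}. ennreal (coeff j k * work k (entry j a))) \<partial>D)"
    by (simp add: nn_integral_add nn_integral_sum)
  also have "\<dots> \<le> (\<integral>\<^sup>+a. ennreal (R a) \<partial>D)"
  proof (intro nn_integral_mono_AE eventually_mono[OF AE_D])
    fix a :: real assume a: "0 < a \<and> a \<le> 1"
    have "0 \<le> entry j a" using alpha_point_nonneg[OF j] a by (simp add: entry_eq)
    moreover have "0 \<le> coeff j k * work k (entry j a)" for k
      using coeff_nonneg[OF j] work_nonneg by simp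
    ultimately have "ennreal (entry j a) + (\<Sum>k\<in>{1..n} - {j}. ennreal (coeff j k * work k (entry j a)))
      = ennreal (entry j a + (\<Sum>k\<in>{1..n} - {j}. coeff j k * work k (entry j a)))"
      by (simp add: sum_ennreal ennreal_plus sum_nonneg)
    also have "\<dots> \<le> ennreal (R a)"
      unfolding R_def u_def using entry_plus_delays_le[OF j, of a] a by (intro ennreal_leI) auto
    finally show "ennreal (entry j a) + (\<Sum>k\<in>{1..n} - {j}. ennreal (coeff j k * work k (entry j a)))
      \<le> ennreal (R a)" .
  qed
  also have "\<dots> = ennreal (\<integral>a. R a \<partial>D)"
  proof (rule nn_integral_eq_integral[OF intR], rule eventually_mono[OF AE_D])
    fix a :: real assume a: "0 < a \<and> a \<le> 1"
    have "0 < q k" if "k \<in> {1..<j}" for k using q_pos[of k] that j by auto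
    then show "0 \<le> R a" unfolding R_def using c idle0 h qj a
      by (intro add_nonneg_nonneg sum_nonneg mult_nonneg_nonneg) (auto simp: less_imp_le)
  qed
  also have "(\<integral>a. R a \<partial>D) = c * idle j (r j) + mu * q j +
      (\<Sum>k=1..<j. (1 + H 1) * q k * (\<integral>a. indicator {u k<..} a \<partial>D))"
  proof -
    let ?T = "\<lambda>k a. (1 + H 1) * q k * indicator {u k<..} a"
    have "(\<integral>a. R a \<partial>D) = (\<integral>a. c * idle j (r j) + a * q j \<partial>D) + (\<integral>a. (\<Sum>k=1..<j. ?T k a) \<partial>D)"
      unfolding R_def by (intro Bochner_Integration.integral_add Bochner_Integration.integrable_sum) auto
    moreover have "(\<integral>a. (\<Sum>k=1..<j. ?T k a) \<partial>D) = (\<Sum>k=1..<j. \<integral>a. ?T k a \<partial>D)"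
      by (rule Bochner_Integration.integral_sum) simp
    ultimately show ?thesis by (simp add: mu_def)
  qed
  finally have *: "(\<integral>\<^sup>+\<omega>. ennreal (p j \<omega> + entry j (\<alpha> j \<omega>) + (\<Sum>k\<in>{1..n} - {j}. delay j k \<omega>)) \<partial>M) \<le>
      ennreal (q j) + ennreal (c * idle j (r j) + mu * q j +
      (\<Sum>k=1..<j. (1 + H 1) * q k * (\<integral>a. indicator {u k<..} a \<partial>D)))"
    by (simp add: add_left_mono add_right_mono)
  \<comment> \<open>The tail bound is applied at \<open>u k\<close>, the fraction of
    \<open>j\<close> done when \<open>k\<close> is released; \<open>1 - u k\<close> is the matching
    factor in the mean busy time.\<close>
  have "(\<Sum>k=1..<j. (1 + H 1) * q k * (\<integral>a. indicator {u k<..} a \<partial>D)) \<le> (\<Sum>k=1..<j. c * (q k * (1 - u k)))"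
  proof (rule sum_mono)
    fix k assume "k \<in> {1..<j}"
    then have "0 \<le> q k" using q_pos[of k] j by (auto simp: less_imp_le)
    from mult_left_mono[OF prob_alpha_greater_le[OF u(1) u(2)] this]
    show "(1 + H 1) * q k * (\<integral>a. indicator {u k<..} a \<partial>D) \<le> c * (q k * (1 - u k))"
      by (simp add: mult_ac)
  qed
  \<comment> \<open>The processing of \<open>j\<close> itself together with its mean share before
    entry is paid by the two halves of \<open>q j\<close> in the target.\<close>
  moreover have "(1 + mu) * q j \<le> c * q j"
    using one_plus_H_le mu_le_H_1[OF j] qj by (intro mult_right_mono) auto
  moreover have "mean_busy_time q I j = idle j (r j) + q j / 2 + (\<Sum>k=1..<j. q k * (1 - u k))"
  proof -
    have "q k * (q j - work j (r k)) / q j = q k * (1 - u k)" for k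
      using qj by (simp add: u_def field_simps)
    then show ?thesis
      unfolding mean_busy_time_eq[OF j] busy_moment_job[OF j]
      using qj by (simp add: add_divide_distrib sum_divide_distrib power2_eq_square)
  qed
  ultimately have "q j + (c * idle j (r j) + mu * q j +
      (\<Sum>k=1..<j. (1 + H 1) * q k * (\<integral>a. indicator {u k<..} a \<partial>D))) \<le> c * (mean_busy_time q I j + q j / 2)"
    by (simp add: algebra_simps sum_distrib_left)
  moreover have "0 \<le> c * idle j (r j) + mu * q j +
      (\<Sum>k=1..<j. (1 + H 1) * q k * (\<integral>a. indicator {u k<..} a \<partial>D))"
  proof -
    have "0 \<le> q k" if "k \<in> {1..<j}" for k using q_pos[of k] that j by (auto simp: less_imp_le)
    then show ?thesis using c idle0 h qj mu_bounds
      by (intro add_nonneg_nonneg sum_nonneg mult_nonneg_nonneg) (auto simp: less_imp_le)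
  qed
  ultimately show ?thesis
    using qj by (intro order_trans[OF *])
      (simp add: ennreal_plus[symmetric] ennreal_leI del: ennreal_plus)
qed

lemma rsos_bound:
  assumes w: "\<And>j. j \<in> {1..n} \<Longrightarrow> 0 \<le> w j"
  shows "(\<integral>\<^sup>+\<omega>. ennreal (\<Sum>j=1..n. w j * rsos_completion n q I (\<lambda>i. \<alpha> i \<omega>) (\<lambda>i. p i \<omega>) j) \<partial>M) \<le>
    ennreal (c * (\<Sum>j=1..n. w j * (mean_busy_time q I j + q j / 2)))"
proof -
  define Z where "Z j \<omega> = p j \<omega> + entry j (\<alpha> j \<omega>) + (\<Sum>k\<in>{1..n} - {j}. delay j k \<omega>)" for j \<omega>
  have Z_measurable [measurable]: "Z j \<in> borel_measurable M" if j: "j \<in> {1..n}" for j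
  proof -
    note [measurable] = entry_measurable[OF j] delay_measurable[OF j]
    show ?thesis unfolding Z_def using j by measurable
  qed
  have "AE \<omega> in M. \<forall>j\<in>{1..n}. 0 < \<alpha> j \<omega> \<and> \<alpha> j \<omega> \<le> 1"
    using AE_alpha by (intro AE_finite_allI) auto
  then have "AE \<omega> in M. ennreal (\<Sum>j=1..n. w j * rsos_completion n q I (\<lambda>i. \<alpha> i \<omega>) (\<lambda>i. p i \<omega>) j)
      \<le> (\<Sum>j=1..n. ennreal (w j) * ennreal (Z j \<omega>))"
  proof eventually_elim
    case (elim \<omega>)
    have "(\<Sum>j=1..n. w j * rsos_completion n q I (\<lambda>i. \<alpha> i \<omega>) (\<lambda>i. p i \<omega>) j) \<le> (\<Sum>j=1..n. w j * Z j \<omega>)"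
    proof (intro sum_mono mult_left_mono)
      fix j assume j: "j \<in> {1..n}"
      show "rsos_completion n q I (\<lambda>i. \<alpha> i \<omega>) (\<lambda>i. p i \<omega>) j \<le> Z j \<omega>"
        using rsos_completion_le[OF j, of "\<lambda>i. \<alpha> i \<omega>" "\<lambda>i. p i \<omega>"] elim
          entry_eq[of "\<alpha> j \<omega>" j] bspec[OF elim j]
        unfolding Z_def delay_def by (simp only:)
    qed (use w in auto)
    then have "ennreal (\<Sum>j=1..n. w j * rsos_completion n q I (\<lambda>i. \<alpha> i \<omega>) (\<lambda>i. p i \<omega>) j) \<le>
        ennreal (\<Sum>j=1..n. w j * Z j \<omega>)" by (rule ennreal_leI)
    also have "\<dots> \<le> (\<Sum>j=1..n. ennreal (w j * Z j \<omega>))" by (rule ennreal_sum_le)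
    also have "\<dots> = (\<Sum>j=1..n. ennreal (w j) * ennreal (Z j \<omega>))"
      using w by (intro sum.cong refl ennreal_mult') auto
    finally show ?case .
  qed
  then have "(\<integral>\<^sup>+\<omega>. ennreal (\<Sum>j=1..n. w j * rsos_completion n q I (\<lambda>i. \<alpha> i \<omega>) (\<lambda>i. p i \<omega>) j) \<partial>M) \<le>
      (\<integral>\<^sup>+\<omega>. (\<Sum>j=1..n. ennreal (w j) * ennreal (Z j \<omega>)) \<partial>M)"
    by (rule nn_integral_mono_AE)
  also have "\<dots> = (\<Sum>j=1..n. ennreal (w j) * (\<integral>\<^sup>+\<omega>. ennreal (Z j \<omega>) \<partial>M))"
    by (subst nn_integral_sum) (auto intro!: sum.cong nn_integral_cmult)
  also have "\<dots> \<le> (\<Sum>j=1..n. ennreal (w j) * ennreal (c * (mean_busy_time q I j + q j / 2)))"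
    unfolding Z_def by (intro sum_mono mult_left_mono rsos_job_bound) auto
  also have "\<dots> = (\<Sum>j=1..n. ennreal (w j * (c * (mean_busy_time q I j + q j / 2))))"
    using w by (intro sum.cong refl ennreal_mult'[symmetric]) auto
  also have "\<dots> = ennreal (\<Sum>j=1..n. w j * (c * (mean_busy_time q I j + q j / 2)))"
  proof (rule sum_ennreal)
    fix j assume j: "j \<in> {1..n}"
    have "0 \<le> busy_moment j" unfolding busy_moment_def
      using run_nonneg run_outside by (intro integral_nonneg_AE AE_I2) (metis linorder_not_less mult_nonneg_nonneg mult_zero_left order_refl)
    then have "0 \<le> mean_busy_time q I j + q j / 2"
      using q_pos[OF j] by (simp add: mean_busy_time_eq[OF j])
    moreover have "0 \<le> c" using one_plus_H_le mu_le_H_1[OF j] mu_bounds by linarith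
    ultimately show "0 \<le> w j * (c * (mean_busy_time q I j + q j / 2))" using w[OF j] by simp
  qed
  also have "(\<Sum>j=1..n. w j * (c * (mean_busy_time q I j + q j / 2))) =
      c * (\<Sum>j=1..n. w j * (mean_busy_time q I j + q j / 2))"
    by (simp add: sum_distrib_left mult_ac)
  finally show ?thesis .
qed

end

lemma (in prob_space) indep_vars_Inl:
  assumes "indep_vars (\<lambda>_. borel) (case_sum X Y) (A <+> B)"
  shows "indep_vars (\<lambda>_. borel) X A"
proof -
  have "indep_vars (\<lambda>j. Pi\<^sub>M {Inl j} (\<lambda>_. borel))
      (\<lambda>j \<omega>. restrict (\<lambda>i. case_sum X Y i \<omega>) {Inl j}) A"
    by (rule indep_vars_restrict[OF assms]) (auto simp: disjoint_family_on_def)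
  then have "indep_vars (\<lambda>_. borel) (\<lambda>j \<omega>. (restrict (\<lambda>i. case_sum X Y i \<omega>) {Inl j}) (Inl j)) A"
    by (rule indep_vars_compose2) auto
  then show ?thesis by simp
qed

theorem theorem2:
  fixes M :: "'a measure" and n :: nat
    and w r pbar :: "nat \<Rightarrow> real"
    and p \<alpha> :: "nat \<Rightarrow> 'a \<Rightarrow> real"
    and f :: "real \<Rightarrow> real" and \<Delta> c :: real
    and I :: "nat \<Rightarrow> real \<Rightarrow> real"
  assumes "prob_space M"
    and "\<And>j. j \<in> {1..n} \<Longrightarrow> 0 \<le> w j"
    and "\<And>j. j \<in> {1..n} \<Longrightarrow> 0 \<le> r j"
    and "\<And>j. j \<in> {1..n} \<Longrightarrow> AE \<omega> in M. 0 \<le> p j \<omega>"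
    and "\<And>j. j \<in> {1..n} \<Longrightarrow> integrable M (p j)"
    and "\<And>j. j \<in> {1..n} \<Longrightarrow> integrable M (\<lambda>\<omega>. (p j \<omega>)\<^sup>2)"
    and "\<And>j. j \<in> {1..n} \<Longrightarrow> pbar j = prob_space.expectation M (p j)"
    and "\<And>j. j \<in> {1..n} \<Longrightarrow> 0 < pbar j"
    and "\<And>j. j \<in> {1..n} \<Longrightarrow> cv_squared M (p j) \<le> \<Delta>"
    and "\<And>i j. i \<in> {1..n} \<Longrightarrow> j \<in> {1..n} \<Longrightarrow> i \<le> j \<Longrightarrow> w i / pbar i \<ge> w j / pbar j"
    and "unit_density f"
    and "\<And>j. j \<in> {1..n} \<Longrightarrow>
           distributed M lborel (\<alpha> j) (\<lambda>x. ennreal (f x * indicator {0<..1} x))"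
    and "prob_space.indep_vars M (\<lambda>_. borel) (case_sum p \<alpha>) ({1..n} <+> {1..n})"
    and "\<And>x. x \<in> {0<..1} \<Longrightarrow>
           (LBINT a:{0<..x}. (1 - gfun \<Delta> * (x - a)) * f a) \<le> (c - 1) * x"
    and "\<And>x. x \<in> {0<..1} \<Longrightarrow>
           (2 - gfun \<Delta> * (1 - (LBINT a:{0<..1}. a * f a))) * (LBINT a:{1-x<..1}. f a) \<le> c * x"
    and "preemptive_wspt n r pbar I"
  shows "(\<integral>\<^sup>+\<omega>. ennreal (\<Sum>j=1..n. w j *
              rsos_completion n pbar I (\<lambda>i. \<alpha> i \<omega>) (\<lambda>i. p i \<omega>) j) \<partial>M) \<le> ennreal (c * (\<Sum>j=1..n. w j * (mean_busy_time pbar I j + pbar j / 2)))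
    \<and> (\<forall>OPT. optimal_policy M n r w p OPT \<longrightarrow>
          ennreal (c * (\<Sum>j=1..n. w j * (mean_busy_time pbar I j + pbar j / 2))) \<le> ennreal c * policy_cost M n w p OPT)
    \<and> ennreal (c * (\<Sum>j=1..n. w j * (mean_busy_time pbar I j + pbar j / 2))) \<le> ennreal c * optimal_cost M n r w p"
proof -
  interpret prob_space M by fact
  interpret rsos_setting M n r pbar I p \<alpha> f \<Delta> c
    using assms indep_vars_Inl[OF assms(13)] by unfold_locales auto
  let ?K = "\<Sum>j=1..n. w j * (mean_busy_time pbar I j + pbar j / 2)"
  have lower: "ennreal (c * ?K) \<le> ennreal c * policy_cost M n w p P" if "scheduling_policy n r P" for P
  proof (cases "n = 0")
    case False
    \<comment> \<open>The sign of \<open>c\<close> is obtained from the presence of a job; without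
      jobs the left side is 0.\<close>
    then have "0 \<le> c" using coeff_nonneg[of 1 1] by (simp add: coeff_def)
    then show ?thesis
      using policy_cost_lower_bound[OF assms(2,10) that] by (simp add: ennreal_mult' mult_left_mono)
  qed simp
  show ?thesis
  proof (intro conjI allI impI)
    show "(\<integral>\<^sup>+\<omega>. ennreal (\<Sum>j=1..n. w j *
              rsos_completion n pbar I (\<lambda>i. \<alpha> i \<omega>) (\<lambda>i. p i \<omega>) j) \<partial>M) \<le> ennreal (c * ?K)"
      using assms(2) by (rule rsos_bound)
    show "ennreal (c * ?K) \<le> ennreal c * policy_cost M n w p OPT" if "optimal_policy M n r w p OPT" for OPT
      using that lower unfolding optimal_policy_def by blast
    \<comment> \<open>The infimum form does not presuppose that an optimal policy exists.\<close>
    show "ennreal (c * ?K) \<le> ennreal c * optimal_cost M n r w p"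
    proof (cases "n = 0")
      case False
      then have "0 \<le> c" using coeff_nonneg[of 1 1] by (simp add: coeff_def)
      moreover have "ennreal ?K \<le> optimal_cost M n r w p"
        unfolding optimal_cost_def
        using policy_cost_lower_bound[OF assms(2,10)] by (intro INF_greatest) auto
      ultimately show ?thesis by (simp add: ennreal_mult' mult_left_mono)
    qed simp
  qed
qed

end
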